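(* For each $n\in\mathbb{N}$ let $X^{(n)}=(X_1^{(n)},\dots,X_m^{(n)})$ be a tuple of independent $n\times n$ random matrices, and let $x=(x_1,\dots,x_m)$ be a tuple of freely independent random variables in some $C^*$-probability space $(\mathcal{A},\tau)$ with faithful trace. Assume that $X^{(n)}$ strongly converges to $x$ almost surely. Then for any non-commutative rational expression $r$ in $2m$ indeterminates with $(x,x^* )$ in its domain, the following holds for almost every $\omega$ in the underlying probability space: $(X^{(n)}(\omega),(X^{(n)}(\omega))^* )$ lies in the domain of $r$ for all sufficiently large $n$, and $$\lim_{n\to\infty}\mathrm{tr}_n\big(r(X^{(n)}(\omega),(X^{(n)}(\omega))^* )\big)=\tau\big(r(x,x^* )\big),\qquad \lim_{n\to\infty}\big\|r(X^{(n)}(\omega),(X^{(n)}(\omega))^* )\big\|=\big\|r(x,x^* )\big\|_{\mathcal{A}}.$$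
   Context: All random matrices are complex and defined on a common underlying probability space; $\mathrm{tr}_n$ is the normalized trace on $M_n(\mathbb{C})$ and $\|\cdot\|$ on matrices is the operator norm. A $C^*$-probability space $(\mathcal{A},\tau)$ is a unital $C^*$-algebra $\mathcal{A}$ with a state $\tau$; "with faithful trace" means that $\tau$ is a faithful tracial state. For a tuple $x=(x_1,\dots,x_m)$, write $x^*=(x_1^*,\dots,x_m^* )$, and $(x,x^* )$ for the resulting $2m$-tuple. Almost sure strong convergence: for almost every $\omega$, for every polynomial $p$ (complex coefficients) in $2m$ non-commuting indeterminates, $\lim_n\mathrm{tr}_n(p(X^{(n)}(\omega),(X^{(n)}(\omega))^* ))=\tau(p(x,x^* ))$ and $\lim_n\|p(X^{(n)}(\omega),(X^{(n)}(\omega))^* )\|=\|p(x,x^* )\|_{\mathcal{A}}$. Rational expressions: let $\mathscr{P}$ be the algebra of complex polynomials in $2m$ non-commuting indeterminates. Put $\mathfrak{R}_0=\mathscr{P}$, and for $k\ge1$ let $\mathfrak{R}_k$ be the free complex unital algebra on the alphabet $\mathfrak{R}_{k-1}\cup\mathfrak{R}_{k-1}^{-1}$, where $\mathfrak{R}_{k-1}^{-1}=\{\beta^{-1}:\beta\in\mathfrak{R}_{k-1}\}$ is a set of formal symbols (also $0^{-1}$ is a valid letter). Sending an element of $\mathfrak{R}_{k-1}$ to the corresponding letter gives an inclusion $\mathfrak{R}_{k-1}\to\mathfrak{R}_k$; the direct limit is $\mathfrak{R}_\infty$, and its elements are the rational expressions. Thus a rational expression is a formal finite combination of sums, products and formal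 inverses starting from polynomials. Evaluation and domain: for a $2m$-tuple $a$ in a unital algebra $\mathcal{B}$, polynomials are evaluated as usual; a letter $\beta\in\mathfrak{R}_{k-1}$ is evaluated as $\beta(a)$; a letter $\beta^{-1}$ is evaluated as $\beta(a)^{-1}$, which is defined iff $\beta(a)$ is defined and invertible in $\mathcal{B}$; linear combinations of words are evaluated accordingly when all letters occurring in them can be evaluated. The domain of a rational expression (over $\mathcal{B}$) is the set of tuples $a$ at which its evaluation is defined. *)

theory Defs
  imports
    "HOL-Probability.Probability"
    "HOL-Library.FSet"
    "HOL-Library.Poly_Mapping"
    "Jordan_Normal_Form.Schur_Decomposition"
begin

section \<open>Evaluation of non-commutative polynomials in a complex unital algebra\<close>

text \<open>Algebras are given by the HOL-Algebra record of ring operations and scalar multiplication,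
  so that the matrix algebras of varying size and the \<open>C\<^sup>*\<close>-algebras are treated uniformly.\<close>

locale complex_unital_algebra = ring B for B :: "(complex, 'b) module" (structure) +
  assumes smult_closed: "b \<in> carrier B \<Longrightarrow> c \<odot> b \<in> carrier B"
    and smult_l_distr: "b \<in> carrier B \<Longrightarrow> (c + d) \<odot> b = c \<odot> b \<oplus> d \<odot> b"
    and smult_r_distr: "b \<in> carrier B \<Longrightarrow> b' \<in> carrier B \<Longrightarrow> c \<odot> (b \<oplus> b') = c \<odot> b \<oplus> c \<odot> b'"
    and smult_smult: "b \<in> carrier B \<Longrightarrow> (c * d) \<odot> b = c \<odot> (d \<odot> b)"
    and smult_one: "b \<in> carrier B \<Longrightarrow> 1 \<odot> b = b"
    and smult_mult_left: "b \<in> carrier B \<Longrightarrow> b' \<in> carrier B \<Longrightarrow> (c \<odot> b) \<otimes> b' = c \<odot> (b \<otimes> b')"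
    and smult_mult_right: "b \<in> carrier B \<Longrightarrow> b' \<in> carrier B \<Longrightarrow> b \<otimes> (c \<odot> b') = c \<odot> (b \<otimes> b')"

definition word_eval :: "(complex, 'b) module \<Rightarrow> ('l \<Rightarrow> 'b) \<Rightarrow> 'l list \<Rightarrow> 'b" where
  "word_eval B f w = foldr (\<lambda>l b. f l \<otimes>\<^bsub>B\<^esub> b) w \<one>\<^bsub>B\<^esub>"

text \<open>The free complex unital algebra on \<open>'v\<close>, as the finitely supported functions on words.\<close>

type_synonym 'v ncpoly = "'v list \<Rightarrow>\<^sub>0 complex"

definition poly_eval :: "(complex, 'b) module \<Rightarrow> ('v \<Rightarrow> 'b) \<Rightarrow> 'v ncpoly \<Rightarrow> 'b" where
  "poly_eval B a p =
     (\<Oplus>\<^bsub>B\<^esub> w \<in> Poly_Mapping.keys p. Poly_Mapping.lookup p w \<odot>\<^bsub>B\<^esub> word_eval B a w)"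


section \<open>Non-commutative rational expressions\<close>

datatype 'r letter = Plain 'r | Inverse 'r

text \<open>An element of the free algebra on an alphabet is a finitely supported function from words to
  the complex numbers. Finitely supported functions do not form a bounded natural functor in their
  keys, so for the recursion such a function is stored through its graph over its support, i.e. a
  finite single-valued set of pairs (word, nonzero coefficient). Single-valuedness, the nonvanishing
  of the coefficients and the level structure are imposed by \<open>rat_level\<close>.\<close>

datatype 'v rat_expr =
    Poly "'v ncpoly"
  | Comb "('v rat_expr letter list \<times> complex) fset"

primrec rat_level :: "nat \<Rightarrow> 'v rat_expr set" where
  "rat_level 0 = range Poly"
| "rat_level (Suc k) =
     {Comb S | S. inj_on fst (fset S) \<and>
        (\<forall>(w, c) \<in> fset S. c \<noteq> 0 \<and> set w \<subseteq> Plain ` rat_level k \<union> Inverse ` rat_level k)}"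

text \<open>The inclusion of each level into the next sends an element to the corresponding letter.\<close>

definition rat_incl :: "'v rat_expr \<Rightarrow> 'v rat_expr" where
  "rat_incl r = Comb {|([Plain r], 1)|}"

text \<open>Elements of the direct limit of the levels are denoted by their representatives, which lie in
  the following union. Two representatives of the same element differ by iterates of
  \<open>rat_incl\<close>; by \<open>rat_eval_incl\<close> and \<open>rat_domain_incl\<close> below, domain and evaluation do not
  depend on the choice.\<close>

definition rational_expressions :: "'v rat_expr set" where
  "rational_expressions = (\<Union>k. rat_level k)"

text \<open>In a combination every letter that occurs must be evaluable; \<open>v\<close> collects the values of the
  expressions underlying the letters.\<close>

primrec letter_eval :: "(complex, 'b) module \<Rightarrow> ('r \<Rightarrow> 'b) \<Rightarrow> 'r letter \<Rightarrow> 'b" where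
  "letter_eval B v (Plain r) = v r"
| "letter_eval B v (Inverse r) = inv\<^bsub>B\<^esub> (v r)"

inductive evaluates_to ::
    "(complex, 'b) module \<Rightarrow> ('v \<Rightarrow> 'b) \<Rightarrow> 'v rat_expr \<Rightarrow> 'b \<Rightarrow> bool"
  for B :: "(complex, 'b) module" and a :: "'v \<Rightarrow> 'b" where
  Poly: "evaluates_to B a (Poly p) (poly_eval B a p)"
| Comb: "evaluates_to B a (Comb S)
     (\<Oplus>\<^bsub>B\<^esub> wc \<in> fset S. snd wc \<odot>\<^bsub>B\<^esub> word_eval B (letter_eval B v) (fst wc))"
  if "\<And>w c r. (w, c) \<in> fset S \<Longrightarrow> Plain r \<in> set w \<Longrightarrow> evaluates_to B a r (v r)"
    and "\<And>w c r. (w, c) \<in> fset S \<Longrightarrow> Inverse r \<in> set w \<Longrightarrow>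
           evaluates_to B a r (v r) \<and> v r \<in> Units B"

definition rat_domain :: "(complex, 'b) module \<Rightarrow> 'v rat_expr \<Rightarrow> ('v \<Rightarrow> 'b) set" where
  "rat_domain B r = {a. range a \<subseteq> carrier B \<and> (\<exists>b. evaluates_to B a r b)}"

definition rat_eval :: "(complex, 'b) module \<Rightarrow> ('v \<Rightarrow> 'b) \<Rightarrow> 'v rat_expr \<Rightarrow> 'b" where
  "rat_eval B a r = (THE b. evaluates_to B a r b)"


section \<open>Unital \<open>C\<^sup>*\<close>-algebras and \<open>C\<^sup>*\<close>-probability spaces\<close>

class unital_cstar_algebra = real_normed_algebra_1 + banach +
  fixes scaleC :: "complex \<Rightarrow> 'a \<Rightarrow> 'a" (infixr \<open>*\<^sub>C\<close> 75)
    and adj :: "'a \<Rightarrow> 'a"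
  assumes scaleC_scaleR: "complex_of_real t *\<^sub>C a = t *\<^sub>R a"
    and scaleC_add_left: "(c + d) *\<^sub>C a = c *\<^sub>C a + d *\<^sub>C a"
    and scaleC_add_right: "c *\<^sub>C (a + b) = c *\<^sub>C a + c *\<^sub>C b"
    and scaleC_scaleC: "c *\<^sub>C (d *\<^sub>C a) = (c * d) *\<^sub>C a"
    and scaleC_mult_left: "(c *\<^sub>C a) * b = c *\<^sub>C (a * b)"
    and scaleC_mult_right: "a * (c *\<^sub>C b) = c *\<^sub>C (a * b)"
    and norm_scaleC: "norm (c *\<^sub>C a) = cmod c * norm a"
    and adj_adj: "adj (adj a) = a"
    and adj_add: "adj (a + b) = adj a + adj b"
    and adj_scaleC: "adj (c *\<^sub>C a) = cnj c *\<^sub>C adj a"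
    and adj_mult: "adj (a * b) = adj b * adj a"
    and cstar_identity: "norm (adj a * a) = (norm a)\<^sup>2"

definition cstar_alg :: "(complex, 'a::unital_cstar_algebra) module" where
  "cstar_alg = \<lparr>carrier = UNIV, mult = (*), one = 1, zero = 0, add = (+), smult = (*\<^sub>C)\<rparr>"

definition is_state :: "('a::unital_cstar_algebra \<Rightarrow> complex) \<Rightarrow> bool" where
  "is_state \<tau> \<longleftrightarrow>
     (\<forall>a b. \<tau> (a + b) = \<tau> a + \<tau> b) \<and> (\<forall>c a. \<tau> (c *\<^sub>C a) = c * \<tau> a) \<and>
     (\<forall>a. \<tau> (adj a * a) \<in> \<real>\<^sub>\<ge>\<^sub>0) \<and> \<tau> 1 = 1"

definition is_faithful :: "('a::unital_cstar_algebra \<Rightarrow> complex) \<Rightarrow> bool" where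
  "is_faithful \<tau> \<longleftrightarrow> (\<forall>a. \<tau> (adj a * a) = 0 \<longrightarrow> a = 0)"

definition is_tracial :: "('a::unital_cstar_algebra \<Rightarrow> complex) \<Rightarrow> bool" where
  "is_tracial \<tau> \<longleftrightarrow> (\<forall>a b. \<tau> (a * b) = \<tau> (b * a))"

inductive_set generated_star_alg :: "'a::unital_cstar_algebra set \<Rightarrow> 'a set"
  for S :: "'a set" where
  gen: "a \<in> S \<Longrightarrow> a \<in> generated_star_alg S"
| one: "1 \<in> generated_star_alg S"
| add: "a \<in> generated_star_alg S \<Longrightarrow> b \<in> generated_star_alg S \<Longrightarrow> a + b \<in> generated_star_alg S"
| scale: "a \<in> generated_star_alg S \<Longrightarrow> c *\<^sub>C a \<in> generated_star_alg S"
| mult: "a \<in> generated_star_alg S \<Longrightarrow> b \<in> generated_star_alg S \<Longrightarrow> a * b \<in> generated_star_alg S"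
| star: "a \<in> generated_star_alg S \<Longrightarrow> adj a \<in> generated_star_alg S"

text \<open>The variables need not be self-adjoint; as usual in a \<open>C\<^sup>*\<close>-probability space, freeness of
  variables means freeness of the unital \<open>*\<close>-subalgebras they generate.\<close>

definition freely_independent ::
    "('a::unital_cstar_algebra \<Rightarrow> complex) \<Rightarrow> ('i \<Rightarrow> 'a) \<Rightarrow> bool" where
  "freely_independent \<tau> x \<longleftrightarrow>
     (\<forall>bs :: ('i \<times> 'a) list.
        bs \<noteq> [] \<and> successively (\<lambda>p q. fst p \<noteq> fst q) bs \<and>
        (\<forall>(i, b) \<in> set bs. b \<in> generated_star_alg {x i} \<and> \<tau> b = 0)
        \<longrightarrow> \<tau> (prod_list (map snd bs)) = 0)"


section \<open>Random matrices and strong convergence\<close>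

definition mat_alg :: "nat \<Rightarrow> (complex, complex mat) module" where
  "mat_alg n = module_mat TYPE(complex) n n"

definition ntr :: "complex mat \<Rightarrow> complex" where
  "ntr A = (\<Sum>i<dim_row A. A $$ (i, i)) / of_nat (dim_row A)"

definition vec_l2norm :: "complex vec \<Rightarrow> real" where
  "vec_l2norm v = L2_set (\<lambda>i. cmod (v $ i)) {..<dim_vec v}"

definition mat_opnorm :: "complex mat \<Rightarrow> real" where
  "mat_opnorm A = Sup {vec_l2norm (A *\<^sub>v v) | v. v \<in> carrier_vec (dim_col A) \<and> vec_l2norm v \<le> 1}"

text \<open>The Borel \<open>\<sigma>\<close>-algebra on the \<open>n \<times> n\<close> matrices, generated by the entries.\<close>

definition mat_borel :: "nat \<Rightarrow> complex mat measure" where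
  "mat_borel n = vimage_algebra (carrier_mat n n)
     (\<lambda>A. \<lambda>ij\<in>{..<n} \<times> {..<n}. A $$ ij) (\<Pi>\<^sub>M ij\<in>{..<n} \<times> {..<n}. borel)"

text \<open>The \<open>2m\<close>-tuple consisting of \<open>x\<close> and its adjoints, indexed by \<open>'m + 'm\<close>.\<close>

definition with_adj :: "('b \<Rightarrow> 'b) \<Rightarrow> ('m \<Rightarrow> 'b) \<Rightarrow> 'm + 'm \<Rightarrow> 'b" where
  "with_adj star x = case_sum x (\<lambda>i. star (x i))"

definition strongly_converges ::
    "(nat \<Rightarrow> 'm \<Rightarrow> complex mat) \<Rightarrow> ('a::unital_cstar_algebra \<Rightarrow> complex) \<Rightarrow> ('m \<Rightarrow> 'a) \<Rightarrow> bool" where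
  "strongly_converges A \<tau> x \<longleftrightarrow>
     (\<forall>p :: ('m + 'm) ncpoly.
        ((\<lambda>n. ntr (poly_eval (mat_alg n) (with_adj mat_adjoint (A n)) p))
           \<longlonglongrightarrow> \<tau> (poly_eval cstar_alg (with_adj adj x) p)) \<and>
        ((\<lambda>n. mat_opnorm (poly_eval (mat_alg n) (with_adj mat_adjoint (A n)) p))
           \<longlonglongrightarrow> norm (poly_eval cstar_alg (with_adj adj x) p)))"


section \<open>Well-definedness of evaluation\<close>

context complex_unital_algebra
begin

lemma word_eval_closed:
  "(\<And>l. l \<in> set w \<Longrightarrow> f l \<in> carrier B) \<Longrightarrow> word_eval B f w \<in> carrier B"
  by (induction w) (auto simp: word_eval_def)

lemma word_eval_cong:
  "(\<And>l. l \<in> set w \<Longrightarrow> f l = g l) \<Longrightarrow> word_eval B f w = word_eval B g w"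
  by (induction w) (auto simp: word_eval_def)

lemma evaluates_to_closed:
  assumes "range a \<subseteq> carrier B" "evaluates_to B a r b"
  shows "b \<in> carrier B"
  using assms(2)
proof induction
  case (Poly p)
  show ?case unfolding poly_eval_def
    using assms(1) by (intro finsum_closed) (auto intro!: smult_closed word_eval_closed)
next
  case (Comb S v)
  have "letter_eval B v l \<in> carrier B" if "(w, c) \<in> fset S" "l \<in> set w" for w c l
    using Comb that by (cases l) auto
  then show ?case
    by (intro finsum_closed) (auto intro!: smult_closed word_eval_closed)
qed

lemma evaluates_to_unique:
  assumes a: "range a \<subseteq> carrier B" and "evaluates_to B a r b" "evaluates_to B a r b'"
  shows "b = b'"
  using assms(2,3)
proof (induction arbitrary: b')
  case (Poly p)
  then show ?case by (auto elim: evaluates_to.cases)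
next
  case (Comb S v)
  from Comb.prems obtain v' where
    b': "b' = (\<Oplus> wc \<in> fset S. snd wc \<odot> word_eval B (letter_eval B v') (fst wc))"
    and v': "\<And>w c r. (w, c) \<in> fset S \<Longrightarrow> Plain r \<in> set w \<Longrightarrow> evaluates_to B a r (v' r)"
      "\<And>w c r. (w, c) \<in> fset S \<Longrightarrow> Inverse r \<in> set w \<Longrightarrow> evaluates_to B a r (v' r) \<and> v' r \<in> Units B"
    by (cases rule: evaluates_to.cases) auto
  have eq: "letter_eval B v l = letter_eval B v' l" if "(w, c) \<in> fset S" "l \<in> set w" for w c l
  proof (cases l)
    case (Plain q)
    then have "v q = v' q" using Comb.IH(1)[of w c q] v'(1)[of w c q] that by simp
    then show ?thesis by (simp add: Plain)
  next
    case (Inverse q)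
    then have "v q = v' q" using Comb.IH(2)[of w c q] v'(2)[of w c q] that by simp
    then show ?thesis by (simp add: Inverse)
  qed
  have cl: "letter_eval B v' l \<in> carrier B" if "(w, c) \<in> fset S" "l \<in> set w" for w c l
    using v'[of w c] that evaluates_to_closed[OF a] by (cases l) (simp_all, blast)
  show ?case unfolding b'
  proof (rule finsum_cong')
    show "(\<lambda>wc. snd wc \<odot> word_eval B (letter_eval B v') (fst wc)) \<in> fset S \<rightarrow> carrier B"
      using cl by (auto intro!: smult_closed word_eval_closed)
  next
    fix p assume p: "p \<in> fset S"
    obtain w c where wc: "p = (w, c)" by (cases p)
    have "word_eval B (letter_eval B v) w = word_eval B (letter_eval B v') w"
      by (rule word_eval_cong, rule eq[of w c]) (use p wc in auto)
    then show "snd p \<odot> word_eval B (letter_eval B v) (fst p) =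
               snd p \<odot> word_eval B (letter_eval B v') (fst p)"
      by (simp add: wc)
  qed simp
qed

lemma rat_eval_eqI:
  assumes "range a \<subseteq> carrier B" "evaluates_to B a r b"
  shows "rat_eval B a r = b"
  unfolding rat_eval_def using assms evaluates_to_unique by blast

lemma evaluates_to_incl:
  assumes a: "range a \<subseteq> carrier B"
  shows "evaluates_to B a (rat_incl r) b \<longleftrightarrow> evaluates_to B a r b"
proof -
  have *: "(\<Oplus> wc \<in> fset {|([Plain r], 1)|}. snd wc \<odot> word_eval B (letter_eval B v) (fst wc)) = v r"
    if "v r \<in> carrier B" for v :: "'a rat_expr \<Rightarrow> 'b"
    using that by (simp add: finsum_insert[of "{}", simplified] word_eval_def smult_one)
  show ?thesis
  proof
    assume "evaluates_to B a (rat_incl r) b"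
    then show "evaluates_to B a r b"
      unfolding rat_incl_def
    proof (cases rule: evaluates_to.cases)
      case (Comb v)
      have r: "evaluates_to B a r (v r)" by (rule Comb(2)) auto
      then show ?thesis using Comb(1) *[of v] evaluates_to_closed[OF a r] by simp
    qed
  next
    assume r: "evaluates_to B a r b"
    have "evaluates_to B a (Comb {|([Plain r], 1)|})
      (\<Oplus> wc \<in> fset {|([Plain r], 1)|}. snd wc \<odot> word_eval B (letter_eval B (\<lambda>_. b)) (fst wc))"
      by (rule evaluates_to.Comb) (use r in auto)
    then show "evaluates_to B a (rat_incl r) b"
      using *[of "\<lambda>_. b"] evaluates_to_closed[OF a r] by (simp add: rat_incl_def)
  qed
qed

lemma rat_domain_incl: "rat_domain B (rat_incl r) = rat_domain B r"
  by (auto simp: rat_domain_def evaluates_to_incl)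

lemma rat_eval_incl: "range a \<subseteq> carrier B \<Longrightarrow> rat_eval B a (rat_incl r) = rat_eval B a r"
  by (simp add: rat_eval_def evaluates_to_incl)

end

lemma rat_incl_level: "r \<in> rat_level k \<Longrightarrow> rat_incl r \<in> rat_level (Suc k)"
  by (simp add: rat_incl_def)

lemma complex_unital_algebra_cstar_alg:
  "complex_unital_algebra (cstar_alg :: (complex, 'a::unital_cstar_algebra) module)"
proof (intro complex_unital_algebra.intro complex_unital_algebra_axioms.intro ringI
    abelian_groupI monoidI)
  show "\<exists>b \<in> carrier cstar_alg. b \<oplus>\<^bsub>cstar_alg\<^esub> a = \<zero>\<^bsub>cstar_alg\<^esub>" for a :: 'a
    by (rule bexI[of _ "- a"]) (simp_all add: cstar_alg_def)
  show "1 \<odot>\<^bsub>cstar_alg\<^esub> a = a" for a :: 'a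
    using scaleC_scaleR[of 1 a] by (simp add: cstar_alg_def)
qed (simp_all add: cstar_alg_def algebra_simps scaleC_add_left scaleC_add_right
        scaleC_scaleC scaleC_mult_left scaleC_mult_right)

lemma complex_unital_algebra_mat_alg: "complex_unital_algebra (mat_alg n)"
proof (intro complex_unital_algebra.intro complex_unital_algebra_axioms.intro)
  show "ring (mat_alg n)"
  proof (intro ringI abelian_groupI monoidI)
    show "\<exists>C \<in> carrier (mat_alg n). C \<oplus>\<^bsub>mat_alg n\<^esub> A = \<zero>\<^bsub>mat_alg n\<^esub>"
      if "A \<in> carrier (mat_alg n)" for A
      by (rule bexI[of _ "- A"]) (use that in \<open>auto simp: mat_alg_def module_mat_def\<close>)
  qed (auto simp: mat_alg_def module_mat_def add_mult_distrib_mat mult_add_distrib_mat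
        intro: assoc_mult_mat assoc_add_mat comm_add_mat)
qed (auto simp: mat_alg_def module_mat_def add_smult_distrib_right_mat
        add_smult_distrib_left_mat mult_smult_assoc_mat mult_smult_distrib)

end

theory Submission
  imports Defs "HOL-Analysis.Generalised_Binomial_Theorem"
begin

text \<open>Call a sequence of matrices \<open>S\<^sub>n\<close> and an element \<open>a\<close> approximable if some polynomial \<open>p\<close> is
  simultaneously norm-close to \<open>a\<close> at the limit variables and, for all large \<open>n\<close>, norm-close to \<open>S\<^sub>n\<close>
  at the matrices. Since traces and states are contractive, norms and traces of approximable
  sequences converge. Approximability passes through the algebra operations and the involution. It
  also passes through inverses: if \<open>a\<close> is invertible, then \<open>u = 1 - a\<^sup>*a/c\<close> has norm less than one for
  large \<open>c\<close>, hence so do, with a uniform bound, the corresponding matrices, and the Neumann series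
  \<open>\<Sum>\<^sub>k u\<^sup>k a\<^sup>*/c\<close> approximates the inverse on both sides at the same rate. The evaluations of a
  rational expression are therefore approximable, by induction over the expression.\<close>


section \<open>The operator norm of matrices\<close>

text \<open>The delicate point is the strict bound \<open>norm u < 1\<close>. It is usually read off
  the spectrum of \<open>adj a * a\<close> inside the algebra. Here it is transported from the
  matrices, where vectors make it elementary: if c is at least the squared norm of A, then 1 minus
  \<open>mat_adjoint A * A\<close> over c is a contraction, and it almost fixes every vector of the
  unit ball whose image has length almost one. The algebra has no vectors and sees only limits of
  norms of polynomials, so such a vector is detected through the norm of 1 + u + ... + u^(k-1),
  which its presence forces to be about k. Once the strict bound holds in the algebra, it returns to
  the matrices for all large n with one constant below 1. This yields their invertibility, since a
  kernel vector of A would be fixed by the contraction, and a bound on the inverses that is uniform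
  in n. Contractivity of a state is likewise derived from positivity on elements
  \<open>adj a * a\<close> alone: for \<open>norm b < 1\<close> the element
  \<open>1 - adj b * b\<close> is the square of a self-adjoint one.\<close>

lemma mat_adjoint_carrier [simp]: "A \<in> carrier_mat n m \<Longrightarrow> mat_adjoint A \<in> carrier_mat m n"
  by (auto simp: mat_adjoint_def)

lemma mat_adjoint_index:
  "i < dim_row A \<Longrightarrow> j < dim_col A \<Longrightarrow> mat_adjoint A $$ (j, i) = cnj (A $$ (i, j))"
  by (auto simp: mat_adjoint_def mat_of_rows_index)

lemma dim_mat_adjoint [simp]:
  "dim_row (mat_adjoint A) = dim_col A" "dim_col (mat_adjoint A) = dim_row A"
  by (auto simp: mat_adjoint_def)

lemma mat_adjoint_adjoint [simp]: "mat_adjoint (mat_adjoint A) = (A :: complex mat)"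
  by (rule eq_matI) (auto simp: mat_adjoint_index)

lemma mat_adjoint_add:
  fixes A B :: "complex mat"
  assumes "A \<in> carrier_mat n m" "B \<in> carrier_mat n m"
  shows "mat_adjoint (A + B) = mat_adjoint A + mat_adjoint B"
  by (rule eq_matI) (use assms in \<open>auto simp: mat_adjoint_index\<close>)

lemma mat_adjoint_minus:
  fixes A B :: "complex mat"
  assumes "A \<in> carrier_mat n m" "B \<in> carrier_mat n m"
  shows "mat_adjoint (A - B) = mat_adjoint A - mat_adjoint B"
  by (rule eq_matI) (use assms in \<open>auto simp: mat_adjoint_index\<close>)

lemma mat_adjoint_smult: "mat_adjoint (c \<cdot>\<^sub>m A) = cnj c \<cdot>\<^sub>m mat_adjoint (A :: complex mat)"
  by (rule eq_matI) (auto simp: mat_adjoint_index)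

lemma mat_adjoint_one [simp]: "mat_adjoint (1\<^sub>m n) = (1\<^sub>m n :: complex mat)"
  by (rule eq_matI) (auto simp: mat_adjoint_index)

lemma mat_adjoint_mult:
  fixes A B :: "complex mat"
  assumes "A \<in> carrier_mat n m" "B \<in> carrier_mat m k"
  shows "mat_adjoint (A * B) = mat_adjoint B * mat_adjoint A"
  by (rule eq_matI)
    (use assms in \<open>auto simp: mat_adjoint_index scalar_prod_def mult.commute intro!: sum.cong\<close>)

section \<open>Inner product and Euclidean norm of complex vectors\<close>

lemma cscalar_prod_eq_sum:
  fixes v w :: "complex vec"
  assumes "w \<in> carrier_vec n"
  shows "v \<bullet>c w = (\<Sum>i<n. v $ i * cnj (w $ i))"
  using assms by (auto simp: scalar_prod_def atLeast0LessThan intro!: sum.cong)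

lemma cscalar_prod_adjoint:
  fixes A :: "complex mat"
  assumes A: "A \<in> carrier_mat n m" and v: "v \<in> carrier_vec m" and w: "w \<in> carrier_vec n"
  shows "(A *\<^sub>v v) \<bullet>c w = v \<bullet>c (mat_adjoint A *\<^sub>v w)"
proof -
  have adj: "mat_adjoint A \<in> carrier_mat m n" using A by simp
  have adj_index: "mat_adjoint A $$ (j, i) = cnj (A $$ (i, j))" if "i < n" "j < m" for i j
    using A that by (simp add: mat_adjoint_index)
  have "(A *\<^sub>v v) \<bullet>c w = (\<Sum>i<n. \<Sum>j<m. A $$ (i, j) * v $ j * cnj (w $ i))"
    using A v w by (simp add: cscalar_prod_eq_sum[OF w])
      (auto simp: scalar_prod_def atLeast0LessThan sum_distrib_right intro!: sum.cong)
  also have "\<dots> = (\<Sum>j<m. \<Sum>i<n. A $$ (i, j) * v $ j * cnj (w $ i))"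
    by (rule sum.swap)
  also have "\<dots> = v \<bullet>c (mat_adjoint A *\<^sub>v w)"
    using A v w by (subst cscalar_prod_eq_sum[OF mult_mat_vec_carrier[OF adj w]])
      (auto simp: scalar_prod_def atLeast0LessThan sum_distrib_left adj_index mult_ac
        intro!: sum.cong)
  finally show ?thesis .
qed

lemma vec_l2norm_nonneg [simp]: "0 \<le> vec_l2norm v"
  by (simp add: vec_l2norm_def)

lemma cscalar_prod_self: "v \<bullet>c v = complex_of_real ((vec_l2norm v)\<^sup>2)"
proof -
  have "v \<bullet>c v = (\<Sum>i<dim_vec v. complex_of_real ((cmod (v $ i))\<^sup>2))"
    by (simp only: cscalar_prod_eq_sum[OF carrier_vec_dim_vec] complex_norm_square)
  then show ?thesis by (simp add: vec_l2norm_def L2_set_def sum_nonneg)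
qed

lemma cmod_sum_mult_le:
  "cmod (\<Sum>i\<in>I. f i * g i) \<le> L2_set (\<lambda>i. cmod (f i)) I * L2_set (\<lambda>i. cmod (g i)) I"
proof -
  have "cmod (\<Sum>i\<in>I. f i * g i) \<le> (\<Sum>i\<in>I. \<bar>cmod (f i)\<bar> * \<bar>cmod (g i)\<bar>)"
    using norm_sum[of "\<lambda>i. f i * g i" I] by (simp add: norm_mult)
  then show ?thesis using L2_set_mult_ineq[of "\<lambda>i. cmod (f i)" "\<lambda>i. cmod (g i)" I]
    by (rule order_trans)
qed

lemma cmod_cscalar_prod_le:
  assumes "v \<in> carrier_vec n" "w \<in> carrier_vec n"
  shows "cmod (v \<bullet>c w) \<le> vec_l2norm v * vec_l2norm w"
  using cmod_sum_mult_le[of "\<lambda>i. v $ i" "\<lambda>i. cnj (w $ i)" "{..<n}"] assms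
  by (simp add: cscalar_prod_eq_sum[of _ n] vec_l2norm_def)

lemma vec_l2norm_smult: "vec_l2norm (c \<cdot>\<^sub>v v) = cmod c * vec_l2norm v"
  by (auto simp: vec_l2norm_def norm_mult L2_set_right_distrib intro!: L2_set_cong)

lemma vec_l2norm_add_le:
  assumes "v \<in> carrier_vec n" "w \<in> carrier_vec n"
  shows "vec_l2norm (v + w) \<le> vec_l2norm v + vec_l2norm w"
proof -
  have "vec_l2norm (v + w) \<le> L2_set (\<lambda>i. cmod (v $ i) + cmod (w $ i)) {..<n}"
    unfolding vec_l2norm_def using assms by (auto intro!: L2_set_mono norm_triangle_ineq)
  also have "\<dots> \<le> vec_l2norm v + vec_l2norm w"
    using L2_set_triangle_ineq[of "\<lambda>i. cmod (v $ i)" "\<lambda>i. cmod (w $ i)" "{..<n}"] assms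
    by (simp add: vec_l2norm_def)
  finally show ?thesis .
qed

lemma vec_l2norm_eq_0_iff:
  assumes "v \<in> carrier_vec n"
  shows "vec_l2norm v = 0 \<longleftrightarrow> v = 0\<^sub>v n"
  using assms by (auto simp: vec_l2norm_def L2_set_eq_0_iff)

section \<open>The operator norm: supremum, triangle inequality, products, adjoints\<close>

text \<open>A crude estimate by Cauchy-Schwarz in each row. It serves to show that the supremum
  defining \<open>mat_opnorm\<close> is taken over a bounded set.\<close>

lemma vec_l2norm_mult_bound:
  assumes "v \<in> carrier_vec (dim_col A)"
  shows "vec_l2norm (A *\<^sub>v v) \<le>
    (\<Sum>i<dim_row A. L2_set (\<lambda>j. cmod (A $$ (i, j))) {..<dim_col A}) * vec_l2norm v"
proof -
  have "vec_l2norm (A *\<^sub>v v) \<le> (\<Sum>i<dim_row A. cmod (row A i \<bullet> v))"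
    unfolding vec_l2norm_def by (rule order_trans[OF L2_set_le_sum]) auto
  also have "\<dots> \<le> (\<Sum>i<dim_row A. L2_set (\<lambda>j. cmod (A $$ (i, j))) {..<dim_col A} * vec_l2norm v)"
  proof (rule sum_mono)
    fix i assume "i \<in> {..<dim_row A}"
    then show "cmod (row A i \<bullet> v) \<le> L2_set (\<lambda>j. cmod (A $$ (i, j))) {..<dim_col A} * vec_l2norm v"
      using cmod_sum_mult_le[of "\<lambda>j. A $$ (i, j)" "\<lambda>j. v $ j" "{..<dim_col A}"] assms
      by (simp add: scalar_prod_def atLeast0LessThan vec_l2norm_def)
  qed
  finally show ?thesis by (simp add: sum_distrib_right)
qed

lemma mat_opnorm_bdd_above:
  "bdd_above {vec_l2norm (A *\<^sub>v v) | v. v \<in> carrier_vec (dim_col A) \<and> vec_l2norm v \<le> 1}"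
proof -
  have "vec_l2norm (A *\<^sub>v v) \<le> (\<Sum>i<dim_row A. L2_set (\<lambda>j. cmod (A $$ (i, j))) {..<dim_col A})"
    if "v \<in> carrier_vec (dim_col A)" "vec_l2norm v \<le> 1" for v
    by (rule order_trans[OF vec_l2norm_mult_bound[OF that(1)]])
      (simp add: mult_left_le that(2) sum_nonneg)
  then show ?thesis by (auto simp: bdd_above_def)
qed

lemma mat_opnorm_upper:
  "v \<in> carrier_vec (dim_col A) \<Longrightarrow> vec_l2norm v \<le> 1 \<Longrightarrow> vec_l2norm (A *\<^sub>v v) \<le> mat_opnorm A"
  unfolding mat_opnorm_def by (rule cSup_upper[OF _ mat_opnorm_bdd_above]) auto

lemma vec_l2norm_zero [simp]: "vec_l2norm (0\<^sub>v n) = 0"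
  using vec_l2norm_eq_0_iff[of "0\<^sub>v n" n] by simp

lemma mat_opnorm_nonneg [simp]: "0 \<le> mat_opnorm A"
  using order_trans[OF vec_l2norm_nonneg mat_opnorm_upper[of "0\<^sub>v (dim_col A)" A]] by simp

lemma vec_l2norm_mult_le:
  assumes "A \<in> carrier_mat n m" "v \<in> carrier_vec m"
  shows "vec_l2norm (A *\<^sub>v v) \<le> mat_opnorm A * vec_l2norm v"
proof (cases "vec_l2norm v = 0")
  case True
  then have "v = 0\<^sub>v m" using assms vec_l2norm_eq_0_iff by blast
  moreover have "A *\<^sub>v 0\<^sub>v m = 0\<^sub>v n" using assms by auto
  ultimately show ?thesis by simp
next
  case False
  define t where "t = vec_l2norm v"
  have t: "t > 0" using False by (simp add: t_def less_le)
  have "vec_l2norm (A *\<^sub>v (complex_of_real (1 / t) \<cdot>\<^sub>v v)) \<le> mat_opnorm A"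
    by (rule mat_opnorm_upper) (use assms t in \<open>auto simp: vec_l2norm_smult t_def norm_divide\<close>)
  also have "A *\<^sub>v (complex_of_real (1 / t) \<cdot>\<^sub>v v) = complex_of_real (1 / t) \<cdot>\<^sub>v (A *\<^sub>v v)"
    using assms by (simp add: mult_mat_vec)
  finally show ?thesis using t by (simp add: vec_l2norm_smult norm_divide field_simps t_def)
qed

lemma mat_opnorm_leI:
  assumes "A \<in> carrier_mat n m" "0 \<le> K"
    and "\<And>v. v \<in> carrier_vec m \<Longrightarrow> vec_l2norm (A *\<^sub>v v) \<le> K * vec_l2norm v"
  shows "mat_opnorm A \<le> K"
  unfolding mat_opnorm_def
proof (rule cSup_least)
  have "vec_l2norm (A *\<^sub>v 0\<^sub>v m)
      \<in> {vec_l2norm (A *\<^sub>v v) | v. v \<in> carrier_vec (dim_col A) \<and> vec_l2norm v \<le> 1}"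
    using assms(1) by (intro CollectI exI[of _ "0\<^sub>v m"]) auto
  then show "{vec_l2norm (A *\<^sub>v v) | v. v \<in> carrier_vec (dim_col A) \<and> vec_l2norm v \<le> 1} \<noteq> {}"
    by blast
next
  fix s assume "s \<in> {vec_l2norm (A *\<^sub>v v) | v. v \<in> carrier_vec (dim_col A) \<and> vec_l2norm v \<le> 1}"
  then obtain v where v: "s = vec_l2norm (A *\<^sub>v v)" "v \<in> carrier_vec m" "vec_l2norm v \<le> 1"
    using assms(1) by auto
  then show "s \<le> K"
    using assms(3)[OF v(2)] mult_left_le[OF v(3) assms(2)] by simp
qed

lemma mat_opnorm_add_le:
  assumes "A \<in> carrier_mat n m" "B \<in> carrier_mat n m"
  shows "mat_opnorm (A + B) \<le> mat_opnorm A + mat_opnorm B"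
proof (rule mat_opnorm_leI[of _ n m])
  fix v :: "complex vec" assume v: "v \<in> carrier_vec m"
  have "vec_l2norm ((A + B) *\<^sub>v v) \<le> vec_l2norm (A *\<^sub>v v) + vec_l2norm (B *\<^sub>v v)"
    using assms v by (simp add: add_mult_distrib_mat_vec[of _ n m] vec_l2norm_add_le[of _ n])
  also have "\<dots> \<le> (mat_opnorm A + mat_opnorm B) * vec_l2norm v"
    using vec_l2norm_mult_le[OF assms(1) v] vec_l2norm_mult_le[OF assms(2) v]
    by (simp add: distrib_right)
  finally show "vec_l2norm ((A + B) *\<^sub>v v) \<le> (mat_opnorm A + mat_opnorm B) * vec_l2norm v" .
qed (use assms in auto)

lemma mat_opnorm_smult_le:
  assumes "A \<in> carrier_mat n m"
  shows "mat_opnorm (c \<cdot>\<^sub>m A) \<le> cmod c * mat_opnorm A"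
proof (rule mat_opnorm_leI[of _ n m])
  fix v :: "complex vec" assume v: "v \<in> carrier_vec m"
  have "(c \<cdot>\<^sub>m A) *\<^sub>v v = c \<cdot>\<^sub>v (A *\<^sub>v v)"
    using assms v by (intro eq_vecI) auto
  then show "vec_l2norm ((c \<cdot>\<^sub>m A) *\<^sub>v v) \<le> cmod c * mat_opnorm A * vec_l2norm v"
    using vec_l2norm_mult_le[OF assms v] by (simp add: vec_l2norm_smult mult_left_mono mult.assoc)
qed (use assms in auto)

lemma mat_opnorm_minus_commute:
  assumes "A \<in> carrier_mat n m" "B \<in> carrier_mat n m"
  shows "mat_opnorm (A - B) = mat_opnorm (B - A)"
proof -
  have "mat_opnorm (A - B) \<le> mat_opnorm (B - A)"
    if "A \<in> carrier_mat n m" "B \<in> carrier_mat n m" for A B :: "complex mat"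
  proof -
    have "A - B = (-1) \<cdot>\<^sub>m (B - A)" using that by (intro eq_matI) auto
    then show ?thesis using mat_opnorm_smult_le[of "B - A" n m "-1"] that by (simp add: minus_carrier_mat)
  qed
  then show ?thesis using assms by (simp add: antisym)
qed

lemma mat_opnorm_triangle:
  assumes "A \<in> carrier_mat n m" "B \<in> carrier_mat n m"
  shows "mat_opnorm A \<le> mat_opnorm (A - B) + mat_opnorm B"
proof -
  have "(A - B) + B = A" using assms by (intro eq_matI) auto
  then show ?thesis using mat_opnorm_add_le[of "A - B" n m B] assms by (simp add: minus_carrier_mat)
qed

lemma mat_opnorm_minus_triangle:
  assumes "A \<in> carrier_mat n m" "B \<in> carrier_mat n m" "C \<in> carrier_mat n m"
  shows "mat_opnorm (A - C) \<le> mat_opnorm (A - B) + mat_opnorm (B - C)"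
proof -
  have "A - C = (A - B) + (B - C)" using assms by (intro eq_matI) auto
  then show ?thesis using mat_opnorm_add_le[of "A - B" n m "B - C"] assms by (simp add: minus_carrier_mat)
qed

lemma mat_opnorm_mult_le:
  assumes "A \<in> carrier_mat n m" "B \<in> carrier_mat m k"
  shows "mat_opnorm (A * B) \<le> mat_opnorm A * mat_opnorm B"
proof (rule mat_opnorm_leI[of _ n k])
  fix v :: "complex vec" assume v: "v \<in> carrier_vec k"
  have "vec_l2norm (A * B *\<^sub>v v) = vec_l2norm (A *\<^sub>v (B *\<^sub>v v))"
    using assms v by (simp add: assoc_mult_mat_vec[of _ n m _ k])
  also have "\<dots> \<le> mat_opnorm A * vec_l2norm (B *\<^sub>v v)"
    using assms v by (intro vec_l2norm_mult_le) auto
  also have "\<dots> \<le> mat_opnorm A * (mat_opnorm B * vec_l2norm v)"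
    by (intro mult_left_mono vec_l2norm_mult_le[OF assms(2) v]) simp
  finally show "vec_l2norm (A * B *\<^sub>v v) \<le> mat_opnorm A * mat_opnorm B * vec_l2norm v"
    by simp
qed (use assms in auto)

text \<open>For z the image of w under the adjoint, the squared length of z is the inner product of
  \<open>A *\<^sub>v z\<close> with w, hence at most \<open>mat_opnorm A\<close> times the lengths
  of z and w. Cancelling the length of z leaves the claim.\<close>

lemma vec_l2norm_adjoint_mult_le:
  assumes "A \<in> carrier_mat n m" "w \<in> carrier_vec n"
  shows "vec_l2norm (mat_adjoint A *\<^sub>v w) \<le> mat_opnorm A * vec_l2norm w"
proof -
  define z where "z = mat_adjoint A *\<^sub>v w"
  have z: "z \<in> carrier_vec m" using assms by (simp add: z_def mult_mat_vec_carrier[of _ m n])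
  have "(vec_l2norm z)\<^sup>2 = cmod (z \<bullet>c z)" by (simp add: cscalar_prod_self norm_power)
  also have "z \<bullet>c z = (A *\<^sub>v z) \<bullet>c w"
    using cscalar_prod_adjoint[OF assms(1) z assms(2)] by (simp add: z_def)
  also have "cmod \<dots> \<le> vec_l2norm (A *\<^sub>v z) * vec_l2norm w"
    using assms z by (intro cmod_cscalar_prod_le[of _ n]) auto
  also have "\<dots> \<le> mat_opnorm A * vec_l2norm z * vec_l2norm w"
    by (intro mult_right_mono vec_l2norm_mult_le[OF assms(1) z]) simp
  finally have "vec_l2norm z * vec_l2norm z \<le> vec_l2norm z * (mat_opnorm A * vec_l2norm w)"
    by (simp add: power2_eq_square mult_ac)
  then have "vec_l2norm z = 0 \<or> vec_l2norm z \<le> mat_opnorm A * vec_l2norm w"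
    by (metis mult_le_cancel_left_pos vec_l2norm_nonneg less_le)
  then show ?thesis by (auto simp: z_def[symmetric])
qed

lemma mat_opnorm_adjoint_le:
  assumes "A \<in> carrier_mat n m"
  shows "mat_opnorm (mat_adjoint A) \<le> mat_opnorm A"
  using vec_l2norm_adjoint_mult_le[OF assms] assms by (intro mat_opnorm_leI[of _ m n]) auto

section \<open>Contractions built from a matrix and its adjoint\<close>

lemma one_minus_adjoint_mult_vec:
  assumes A: "A \<in> carrier_mat n n" and v: "v \<in> carrier_vec n"
  shows "(1\<^sub>m n - c \<cdot>\<^sub>m (mat_adjoint A * A)) *\<^sub>v v = v - c \<cdot>\<^sub>v (mat_adjoint A *\<^sub>v (A *\<^sub>v v))"
proof -
  have AA: "mat_adjoint A * A \<in> carrier_mat n n" using A by (intro mult_carrier_mat) auto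
  have "(c \<cdot>\<^sub>m (mat_adjoint A * A)) *\<^sub>v v = c \<cdot>\<^sub>v ((mat_adjoint A * A) *\<^sub>v v)"
    using AA v by (intro eq_vecI) auto
  also have "(mat_adjoint A * A) *\<^sub>v v = mat_adjoint A *\<^sub>v (A *\<^sub>v v)"
    using A v by (intro assoc_mult_mat_vec[of _ n n _ n]) auto
  finally show ?thesis
    using AA v by (subst minus_mult_distrib_mat_vec[of _ n n]) auto
qed

text \<open>Put w = Av and let d = v - Uv be the adjoint of A applied to w, over c. The cross terms
  of |v - d|^2 are both |w|^2/c, and |d|^2 is at most |w|^2/c because c dominates the squared norm
  of A; hence |v - d|^2 + |d|^2 is at most |v|^2. The consequence of interest: if U almost preserves
  the length of v, then v is almost fixed.\<close>

lemma vec_l2norm_firmly_nonexpansive: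
  assumes A: "A \<in> carrier_mat n n" and c: "0 < c" "(mat_opnorm A)\<^sup>2 \<le> c"
    and U: "U = 1\<^sub>m n - complex_of_real (1 / c) \<cdot>\<^sub>m (mat_adjoint A * A)"
    and v: "v \<in> carrier_vec n"
  shows "(vec_l2norm (v - U *\<^sub>v v))\<^sup>2 \<le> (vec_l2norm v)\<^sup>2 - (vec_l2norm (U *\<^sub>v v))\<^sup>2"
proof -
  define w where "w = A *\<^sub>v v"
  define d where "d = complex_of_real (1 / c) \<cdot>\<^sub>v (mat_adjoint A *\<^sub>v w)"
  have w: "w \<in> carrier_vec n" using A v by (simp add: w_def)
  have z: "mat_adjoint A *\<^sub>v w \<in> carrier_vec n"
    using A w by (simp add: mult_mat_vec_carrier[of _ n n])
  then have d: "d \<in> carrier_vec n" by (simp add: d_def)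
  have Uv: "U *\<^sub>v v = v - d"
    unfolding U d_def w_def by (rule one_minus_adjoint_mult_vec[OF A v])
  have vUv: "v - U *\<^sub>v v = d" using v d by (auto simp: Uv)
  have vd: "v \<bullet>c d = complex_of_real ((vec_l2norm w)\<^sup>2 / c)"
  proof -
    have "v \<bullet>c d = complex_of_real (1 / c) * (v \<bullet>c (mat_adjoint A *\<^sub>v w))"
      using v z by (simp add: d_def conjugate_smult_vec)
    also have "v \<bullet>c (mat_adjoint A *\<^sub>v w) = w \<bullet>c w"
      using cscalar_prod_adjoint[OF A v w] by (simp add: w_def)
    finally show ?thesis by (simp add: cscalar_prod_self)
  qed
  have dv: "d \<bullet>c v = complex_of_real ((vec_l2norm w)\<^sup>2 / c)"
  proof -
    have "d \<bullet>c v = cnj (v \<bullet>c d)"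
      using v d by (simp add: cscalar_prod_eq_sum[of _ n] cnj_sum mult.commute)
    then show ?thesis by (simp add: vd)
  qed
  have "complex_of_real ((vec_l2norm (v - d))\<^sup>2) = (v - d) \<bullet>c (v - d)"
    by (simp only: cscalar_prod_self)
  also have "\<dots> = v \<bullet>c v - v \<bullet>c d - d \<bullet>c v + d \<bullet>c d"
    using v d by (simp add: cscalar_prod_eq_sum[of _ n] sum.distrib sum_subtractf algebra_simps)
  also have "\<dots> = complex_of_real ((vec_l2norm v)\<^sup>2 - 2 * (vec_l2norm w)\<^sup>2 / c + (vec_l2norm d)\<^sup>2)"
    by (simp add: vd dv cscalar_prod_self)
  finally have eq: "(vec_l2norm (v - d))\<^sup>2
      = (vec_l2norm v)\<^sup>2 - 2 * (vec_l2norm w)\<^sup>2 / c + (vec_l2norm d)\<^sup>2"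
    by (simp only: of_real_eq_iff)
  have "vec_l2norm d \<le> mat_opnorm A * vec_l2norm w / c"
    using vec_l2norm_adjoint_mult_le[OF A w] c
    by (simp add: d_def vec_l2norm_smult norm_divide divide_right_mono)
  then have "(vec_l2norm d)\<^sup>2 \<le> (mat_opnorm A * vec_l2norm w / c)\<^sup>2"
    by (intro power_mono) simp_all
  also have "\<dots> = (mat_opnorm A)\<^sup>2 * ((vec_l2norm w)\<^sup>2 / c\<^sup>2)"
    by (simp add: power_mult_distrib power_divide)
  also have "\<dots> \<le> c * ((vec_l2norm w)\<^sup>2 / c\<^sup>2)"
    by (intro mult_right_mono c) simp
  also have "\<dots> = (vec_l2norm w)\<^sup>2 / c" using c by (simp add: power2_eq_square)
  finally show ?thesis unfolding vUv using eq by (simp add: Uv)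
qed

lemma mat_opnorm_one_minus_le:
  assumes A: "A \<in> carrier_mat n n" and c: "0 < c" "(mat_opnorm A)\<^sup>2 \<le> c"
  shows "mat_opnorm (1\<^sub>m n - complex_of_real (1 / c) \<cdot>\<^sub>m (mat_adjoint A * A)) \<le> 1"
proof (rule mat_opnorm_leI[of _ n n])
  let ?U = "1\<^sub>m n - complex_of_real (1 / c) \<cdot>\<^sub>m (mat_adjoint A * A)"
  show "vec_l2norm (?U *\<^sub>v v) \<le> 1 * vec_l2norm v" if "v \<in> carrier_vec n" for v
  proof -
    have "(vec_l2norm (?U *\<^sub>v v))\<^sup>2 \<le> (vec_l2norm v)\<^sup>2"
      using vec_l2norm_firmly_nonexpansive[OF A c refl that] 
        zero_le_power2[of "vec_l2norm (v - ?U *\<^sub>v v)"] by linarith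
    then show ?thesis unfolding mult_1 by (rule power2_le_imp_le) simp
  qed
qed (use A in auto)

text \<open>Each diagonal entry is a coordinate of the image of a unit vector, and the normalized
  trace averages these entries.\<close>

lemma ntr_le_mat_opnorm:
  assumes "A \<in> carrier_mat n n"
  shows "cmod (ntr A) \<le> mat_opnorm A"
proof -
  have diag: "cmod (A $$ (i, i)) \<le> mat_opnorm A" if "i < n" for i
  proof -
    have "vec_l2norm (unit_vec n i) = L2_set (\<lambda>j. if j = i then 1 else 0) {..<n}"
      unfolding vec_l2norm_def using that by (intro L2_set_cong) auto
    also have "\<dots> = sqrt (\<Sum>j<n. if j = i then 1 else 0)"
      unfolding L2_set_def by (intro arg_cong[of _ _ sqrt] sum.cong) auto
    finally have unit: "vec_l2norm (unit_vec n i) = 1" using that by simp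
    have "cmod (A $$ (i, i)) = cmod ((A *\<^sub>v unit_vec n i) $ i)"
      using assms that by simp
    also have "\<dots> \<le> vec_l2norm (A *\<^sub>v unit_vec n i)"
      unfolding vec_l2norm_def using assms that 
      by (intro member_le_L2_set[of _ i "\<lambda>i. cmod ((A *\<^sub>v unit_vec n _) $ i)"]) auto
    also have "\<dots> \<le> mat_opnorm A"
      using assms by (intro mat_opnorm_upper) (auto simp: unit)
    finally show ?thesis .
  qed
  have "cmod (ntr A) = cmod (\<Sum>i<n. A $$ (i, i)) / n"
    using assms by (simp add: ntr_def norm_divide)
  also have "\<dots> \<le> (n * mat_opnorm A) / n"
    using sum_norm_bound[of "{..<n}" "\<lambda>i. A $$ (i, i)" "mat_opnorm A"] diag
    by (intro divide_right_mono) auto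
  \<comment> \<open>Only an inequality, because for n = 0 the quotient is 0 by the convention on
    division.\<close>
  also have "\<dots> \<le> mat_opnorm A" by simp
  finally show ?thesis .
qed

lemma ntr_diff:
  assumes "A \<in> carrier_mat n n" "B \<in> carrier_mat n n"
  shows "ntr (A - B) = ntr A - ntr B"
  using assms by (simp add: ntr_def sum_subtractf diff_divide_distrib)

lemma less_mat_opnormE:
  assumes "A \<in> carrier_mat n m" "s < mat_opnorm A"
  obtains v where "v \<in> carrier_vec m" "vec_l2norm v \<le> 1" "s < vec_l2norm (A *\<^sub>v v)"
proof -
  have "vec_l2norm (A *\<^sub>v 0\<^sub>v m)
      \<in> {vec_l2norm (A *\<^sub>v v) | v. v \<in> carrier_vec (dim_col A) \<and> vec_l2norm v \<le> 1}"
    using assms(1) by (intro CollectI exI[of _ "0\<^sub>v m"]) auto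
  then have "{vec_l2norm (A *\<^sub>v v) | v. v \<in> carrier_vec (dim_col A) \<and> vec_l2norm v \<le> 1} \<noteq> {}"
    by blast
  from less_cSup_iff[OF this mat_opnorm_bdd_above, of s] show ?thesis
    using assms that unfolding mat_opnorm_def by auto
qed

section \<open>Geometric sums of a contraction\<close>

text \<open>Horner form of 1 + U + ... + U^(k-1), with k counting the summands. The recursion has
  the shape of the fixed point equation satisfied by the inverse, which makes the later inductions
  immediate.\<close>

primrec geometric_mat :: "nat \<Rightarrow> complex mat \<Rightarrow> nat \<Rightarrow> complex mat" where
  "geometric_mat n U 0 = 0\<^sub>m n n"
| "geometric_mat n U (Suc k) = 1\<^sub>m n + U * geometric_mat n U k"

lemma geometric_mat_carrier [simp]:
  "U \<in> carrier_mat n n \<Longrightarrow> geometric_mat n U k \<in> carrier_mat n n"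
  by (induction k) auto

text \<open>The difference is the sum of v - U^i v over i < k, and each term is at most i times |v -
  Uv| since U is a contraction. The factor k^2 is a convenient overestimate of k(k-1)/2; the
  induction uses that the difference for k + 1 is U applied to the difference for k, plus k(v -
  Uv).\<close>

lemma geometric_mat_nonexpansive:
  assumes U: "U \<in> carrier_mat n n" "mat_opnorm U \<le> 1" and v: "v \<in> carrier_vec n"
  shows "vec_l2norm (of_nat k \<cdot>\<^sub>v v - geometric_mat n U k *\<^sub>v v)
    \<le> (real k)\<^sup>2 * vec_l2norm (v - U *\<^sub>v v)"
proof (induction k)
  case 0
  have "of_nat 0 \<cdot>\<^sub>v v - geometric_mat n U 0 *\<^sub>v v = 0\<^sub>v n"
    using v by (intro eq_vecI) auto
  then show ?case by simp
next
  case (Suc k)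
  let ?G = "geometric_mat n U k" and ?d = "vec_l2norm (v - U *\<^sub>v v)"
  let ?w = "of_nat k \<cdot>\<^sub>v v - ?G *\<^sub>v v"
  have G: "?G \<in> carrier_mat n n" using U by simp
  have Gv: "?G *\<^sub>v v \<in> carrier_vec n" using G v by (rule mult_mat_vec_carrier)
  have UGv: "U *\<^sub>v (?G *\<^sub>v v) \<in> carrier_vec n" using U(1) Gv by (rule mult_mat_vec_carrier)
  have Uv: "U *\<^sub>v v \<in> carrier_vec n" using U(1) v by (rule mult_mat_vec_carrier)
  have w: "?w \<in> carrier_vec n" using Gv v by simp
  have 1: "geometric_mat n U (Suc k) *\<^sub>v v = v + U *\<^sub>v (?G *\<^sub>v v)"
    using G U(1) v
    by (simp add: add_mult_distrib_mat_vec[of _ n n] assoc_mult_mat_vec[of _ n n _ n])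
  have 2: "U *\<^sub>v ?w = of_nat k \<cdot>\<^sub>v (U *\<^sub>v v) - U *\<^sub>v (?G *\<^sub>v v)"
    using U(1) Gv v by (simp add: mult_minus_distrib_mat_vec[of _ n n] mult_mat_vec)
  have "of_nat (Suc k) \<cdot>\<^sub>v v - geometric_mat n U (Suc k) *\<^sub>v v
      = U *\<^sub>v ?w + of_nat k \<cdot>\<^sub>v (v - U *\<^sub>v v)"
    unfolding 1 2 using U(1) UGv Uv v by (intro eq_vecI) (auto simp: algebra_simps)
  then have "vec_l2norm (of_nat (Suc k) \<cdot>\<^sub>v v - geometric_mat n U (Suc k) *\<^sub>v v)
      \<le> vec_l2norm (U *\<^sub>v ?w) + real k * ?d"
    using vec_l2norm_add_le[of "U *\<^sub>v ?w" n "of_nat k \<cdot>\<^sub>v (v - U *\<^sub>v v)"] U(1) w v Uv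
    by (simp add: vec_l2norm_smult)
  also have "vec_l2norm (U *\<^sub>v ?w) \<le> vec_l2norm ?w"
    using vec_l2norm_mult_le[OF U(1) w] mult_right_mono[OF U(2) vec_l2norm_nonneg[of ?w]]
    by simp
  also note Suc.IH
  also have "(real k)\<^sup>2 * ?d + real k * ?d \<le> (real (Suc k))\<^sup>2 * ?d"
    unfolding distrib_right[symmetric] by (intro mult_right_mono) (auto simp: power2_eq_square algebra_simps)
  finally show ?case by simp
qed

text \<open>A vector of the unit ball that U maps to length above s satisfies |v - Uv|^2 <= 1 - s^2,
  so the geometric sum sends v close to kv. For fixed k the bound tends to k as s tends to
  1.\<close>

lemma geometric_mat_opnorm_ge:
  assumes A: "A \<in> carrier_mat n n" and c: "0 < c" "(mat_opnorm A)\<^sup>2 \<le> c"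
    and U: "U = 1\<^sub>m n - complex_of_real (1 / c) \<cdot>\<^sub>m (mat_adjoint A * A)"
    and s: "0 \<le> s" "s < mat_opnorm U"
  shows "real k * s - (real k)\<^sup>2 * sqrt (1 - s\<^sup>2) \<le> mat_opnorm (geometric_mat n U k)"
proof -
  let ?G = "geometric_mat n U k"
  have Uc: "U \<in> carrier_mat n n" unfolding U using A by auto
  then have G: "?G \<in> carrier_mat n n" by simp
  obtain v where v: "v \<in> carrier_vec n" "vec_l2norm v \<le> 1" "s < vec_l2norm (U *\<^sub>v v)"
    using less_mat_opnormE[OF Uc s(2)] by blast
  have U1: "mat_opnorm U \<le> 1" unfolding U by (rule mat_opnorm_one_minus_le[OF A c])
  have "vec_l2norm (U *\<^sub>v v) \<le> vec_l2norm v"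
    using vec_l2norm_mult_le[OF Uc v(1)] mult_right_mono[OF U1 vec_l2norm_nonneg[of v]] by simp
  then have sv: "s \<le> vec_l2norm v" using v(3) by simp
  have "(vec_l2norm (v - U *\<^sub>v v))\<^sup>2 \<le> (vec_l2norm v)\<^sup>2 - (vec_l2norm (U *\<^sub>v v))\<^sup>2"
    by (rule vec_l2norm_firmly_nonexpansive[OF A c U v(1)])
  also have "\<dots> \<le> 1 - s\<^sup>2"
    using power_mono[OF v(2) vec_l2norm_nonneg, of 2] power_mono[OF less_imp_le[OF v(3)] s(1), of 2]
    unfolding power_one by linarith
  finally have d: "vec_l2norm (v - U *\<^sub>v v) \<le> sqrt (1 - s\<^sup>2)"
    by (rule real_le_rsqrt)
  have Gv: "?G *\<^sub>v v \<in> carrier_vec n" using G v(1) by (rule mult_mat_vec_carrier)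
  have "real k * s \<le> real k * vec_l2norm v" using sv by (rule mult_left_mono) simp
  also have "\<dots> = vec_l2norm ((of_nat k \<cdot>\<^sub>v v - ?G *\<^sub>v v) + ?G *\<^sub>v v)"
  proof -
    have "(of_nat k \<cdot>\<^sub>v v - ?G *\<^sub>v v) + ?G *\<^sub>v v = of_nat k \<cdot>\<^sub>v v"
      using G Gv v(1) by (intro eq_vecI) auto
    then show ?thesis by (simp add: vec_l2norm_smult)
  qed
  also have "\<dots> \<le> vec_l2norm (of_nat k \<cdot>\<^sub>v v - ?G *\<^sub>v v) + vec_l2norm (?G *\<^sub>v v)"
    using Gv v(1) by (intro vec_l2norm_add_le[of _ n]) auto
  also have "\<dots> \<le> (real k)\<^sup>2 * vec_l2norm (v - U *\<^sub>v v) + mat_opnorm ?G"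
    using geometric_mat_nonexpansive[OF Uc U1 v(1), of k] mat_opnorm_upper[of v ?G] G v(1,2)
    by (intro add_mono) auto
  also have "\<dots> \<le> (real k)\<^sup>2 * sqrt (1 - s\<^sup>2) + mat_opnorm ?G"
    using d by (intro add_mono mult_left_mono) auto
  finally show ?thesis by simp
qed

section \<open>Invertibility and the Neumann series for matrices\<close>

text \<open>A nonzero kernel vector of A would be fixed by the contraction, which contradicts norm
  below 1. In finite dimension injectivity suffices, through the determinant.\<close>

lemma mat_inverse_if_contraction:
  assumes A: "A \<in> carrier_mat n n"
    and U: "mat_opnorm (1\<^sub>m n - c \<cdot>\<^sub>m (mat_adjoint A * A)) < 1"
  obtains B where "B \<in> carrier_mat n n" "A * B = 1\<^sub>m n" "B * A = 1\<^sub>m n"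
proof -
  let ?U = "1\<^sub>m n - c \<cdot>\<^sub>m (mat_adjoint A * A)"
  have "det A \<noteq> 0"
  proof
    assume "det A = 0"
    then obtain v where v: "v \<in> carrier_vec n" "v \<noteq> 0\<^sub>v n" "A *\<^sub>v v = 0\<^sub>v n"
      using det_0_iff_vec_prod_zero[OF A] by blast
    have "mat_adjoint A *\<^sub>v 0\<^sub>v n = 0\<^sub>v n"
      using A by (intro eq_vecI) auto
    then have "?U *\<^sub>v v = v"
      using v(1) by (simp add: one_minus_adjoint_mult_vec[OF A v(1)] v(3)) auto
    moreover have "vec_l2norm (?U *\<^sub>v v) \<le> mat_opnorm ?U * vec_l2norm v"
      using A v(1) by (intro vec_l2norm_mult_le[of _ n n]) auto
    moreover have "vec_l2norm v > 0"
      using v vec_l2norm_eq_0_iff[OF v(1)] by (simp add: less_le)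
    ultimately show False using U by simp
  qed
  then have "A \<in> Units (ring_mat TYPE(complex) n ())" by (rule det_non_zero_imp_unit[OF A])
  then show ?thesis using that by (auto simp: Units_def ring_mat_def)
qed

text \<open>Multiplying AB = 1 by the adjoint of A expresses that adjoint through B. The resulting
  equation B = W + UB gives both the norm bound and the Neumann expansion of the inverse.\<close>

lemma mat_inverse_fixpoint:
  assumes A: "A \<in> carrier_mat n n" and B: "B \<in> carrier_mat n n" "A * B = 1\<^sub>m n"
  shows "B = c \<cdot>\<^sub>m mat_adjoint A + (1\<^sub>m n - c \<cdot>\<^sub>m (mat_adjoint A * A)) * B"
proof -
  have AA: "mat_adjoint A * A \<in> carrier_mat n n" using A by (intro mult_carrier_mat) auto
  have "mat_adjoint A * A * B = mat_adjoint A"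
    using A B by (simp add: assoc_mult_mat[of _ n n _ n _ n] right_mult_one_mat[of _ n n])
  then have "(1\<^sub>m n - c \<cdot>\<^sub>m (mat_adjoint A * A)) * B = B - c \<cdot>\<^sub>m mat_adjoint A"
    using AA B by (simp add: minus_mult_distrib_mat[of _ n n _ _ n] mult_smult_assoc_mat[of _ n n _ n])
  then show ?thesis using A B by (intro eq_matI) auto
qed

text \<open>Norms in the fixed point equation give |B| <= |c||A| + \<rho>|B|. The dimension does not
  enter, so the bound is uniform along a sequence of matrices.\<close>

lemma mat_inverse_opnorm_le:
  assumes A: "A \<in> carrier_mat n n" and B: "B \<in> carrier_mat n n" "A * B = 1\<^sub>m n"
    and U: "mat_opnorm (1\<^sub>m n - c \<cdot>\<^sub>m (mat_adjoint A * A)) \<le> \<rho>" "\<rho> < 1"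
  shows "mat_opnorm B \<le> cmod c * mat_opnorm A / (1 - \<rho>)"
proof -
  let ?U = "1\<^sub>m n - c \<cdot>\<^sub>m (mat_adjoint A * A)"
  have Uc: "?U \<in> carrier_mat n n" using A by auto
  have "mat_opnorm B \<le> mat_opnorm (c \<cdot>\<^sub>m mat_adjoint A) + mat_opnorm (?U * B)"
    by (subst mat_inverse_fixpoint[OF A B, of c]) (use A B Uc in \<open>intro mat_opnorm_add_le[of _ n n], auto\<close>)
  also have "mat_opnorm (c \<cdot>\<^sub>m mat_adjoint A) \<le> cmod c * mat_opnorm A"
    using mat_opnorm_smult_le[of "mat_adjoint A" n n c] mat_opnorm_adjoint_le[OF A] A
    by (meson mat_adjoint_carrier mult_left_mono norm_ge_zero order_trans)
  also have "mat_opnorm (?U * B) \<le> \<rho> * mat_opnorm B"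
    using mat_opnorm_mult_le[OF Uc B(1)] mult_right_mono[OF U(1) mat_opnorm_nonneg[of B]] by linarith
  finally show ?thesis using U(2) by (simp add: field_simps)
qed

text \<open>The remainder after k terms is U^k B: subtracting the recursion of the geometric sum
  from the fixed point equation pulls out one factor U at each step.\<close>

lemma mat_inverse_Neumann:
  assumes A: "A \<in> carrier_mat n n" and B: "B \<in> carrier_mat n n" "A * B = 1\<^sub>m n"
    and U: "U = 1\<^sub>m n - c \<cdot>\<^sub>m (mat_adjoint A * A)" "mat_opnorm U \<le> \<rho>"
  shows "mat_opnorm (B - geometric_mat n U k * (c \<cdot>\<^sub>m mat_adjoint A)) \<le> \<rho> ^ k * mat_opnorm B"
proof (induction k)
  case 0
  have "B - geometric_mat n U 0 * (c \<cdot>\<^sub>m mat_adjoint A) = B"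
    using A B by (intro eq_matI) auto
  then show ?case by simp
next
  case (Suc k)
  let ?W = "c \<cdot>\<^sub>m mat_adjoint A" and ?G = "geometric_mat n U k"
  have Uc: "U \<in> carrier_mat n n" unfolding U using A by auto
  have W: "?W \<in> carrier_mat n n" and G: "?G \<in> carrier_mat n n" using A Uc by auto
  have "B - geometric_mat n U (Suc k) * ?W = (?W + U * B) - (?W + U * (?G * ?W))"
    using mat_inverse_fixpoint[OF A B, of c] W G Uc
    by (simp add: U(1)[symmetric] add_mult_distrib_mat[of _ n n _ _ n]
        assoc_mult_mat[of _ n n _ n _ n] left_mult_one_mat[OF W])
  also have "\<dots> = U * B - U * (?G * ?W)"
    using W G Uc B by (intro eq_matI) auto
  also have "\<dots> = U * (B - ?G * ?W)"
    using mult_carrier_mat[OF G W] Uc B by (intro mult_minus_distrib_mat[of _ n n _ n, symmetric]) auto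
  finally have "mat_opnorm (B - geometric_mat n U (Suc k) * ?W)
      \<le> mat_opnorm U * mat_opnorm (B - ?G * ?W)"
    using mat_opnorm_mult_le[OF Uc, of "B - ?G * ?W" n] W G by (simp add: minus_carrier_mat)
  also have "\<dots> \<le> \<rho> * (\<rho> ^ k * mat_opnorm B)"
    using U(2) Suc.IH order_trans[OF mat_opnorm_nonneg U(2)] by (intro mult_mono) auto
  finally show ?case by simp
qed


section \<open>States on \<open>C\<^sup>*\<close>-algebras\<close>

lemma adj_scaleR: "adj (t *\<^sub>R a) = t *\<^sub>R adj (a :: 'a::unital_cstar_algebra)"
  by (metis adj_scaleC complex_cnj_complex_of_real scaleC_scaleR)

lemma adj_one [simp]: "adj 1 = (1 :: 'a::unital_cstar_algebra)"
  by (metis adj_adj adj_mult mult.left_neutral mult.right_neutral)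

lemma norm_adj [simp]: "norm (adj a) = norm (a :: 'a::unital_cstar_algebra)"
proof -
  have le: "norm a \<le> norm (adj a)" for a :: 'a
  proof (cases "norm a = 0")
    case False
    have "norm a * norm a \<le> norm (adj a) * norm a"
      using norm_mult_ineq[of "adj a" a] by (simp add: cstar_identity power2_eq_square)
    then show ?thesis using False by simp
  qed simp
  show ?thesis using le[of a] le[of "adj a"] by (simp add: adj_adj)
qed

lemma bounded_linear_adj: "bounded_linear (adj :: 'a::unital_cstar_algebra \<Rightarrow> 'a)"
  by (rule bounded_linear_intro[of _ 1]) (simp_all add: adj_add adj_scaleR)

lemma adj_diff: "adj (a - b) = adj a - adj (b :: 'a::unital_cstar_algebra)"
  by (rule linear_diff[OF bounded_linear.linear[OF bounded_linear_adj]])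

lemma adj_power: "adj (a ^ n) = adj (a :: 'a::unital_cstar_algebra) ^ n"
  by (induction n) (simp_all add: adj_mult power_commutes)

text \<open>The square root is the binomial series of exponent \<open>1/2\<close>; squaring it is Vandermonde's
  convolution.\<close>

lemma selfadjoint_sqrt_one_minus:
  fixes b :: "'a::unital_cstar_algebra"
  assumes "adj b = b" "norm b < 1"
  obtains z where "adj z = z" "z * z = 1 - b"
proof -
  define f where "f k = ((1 / 2 gchoose k) * (- 1) ^ k) *\<^sub>R b ^ k" for k
  have summ: "summable (\<lambda>k. norm (f k))"
  proof (rule summable_comparison_test')
    show "summable (\<lambda>k. norm ((1 / 2 gchoose k) * norm b ^ k :: real))"
      by (rule abs_summable_in_conv_radius) (use assms in \<open>simp add: conv_radius_gchoose\<close>)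
    show "norm (norm (f k)) \<le> norm ((1 / 2 gchoose k) * norm b ^ k :: real)" if "k \<ge> 0" for k
      by (simp add: f_def abs_mult mult_left_mono norm_power_ineq)
  qed
  define z where "z = suminf f"
  have "adj z = suminf (\<lambda>k. adj (f k))"
    unfolding z_def
    by (rule bounded_linear.suminf[OF bounded_linear_adj summable_norm_cancel[OF summ]])
  also have "\<dots> = z" by (simp add: f_def[abs_def] z_def adj_scaleR adj_power assms(1))
  finally have "adj z = z" .
  moreover have "z * z = 1 - b"
  proof -
    have conv: "(\<Sum>i\<le>k. f i * f (k - i)) = ((of_nat (1 choose k) :: real) * (- 1) ^ k) *\<^sub>R b ^ k" for k
    proof -
      have "f i * f (k - i)
          = ((1 / 2 gchoose i) * (1 / 2 gchoose (k - i)) * (- 1) ^ k) *\<^sub>R b ^ k" if "i \<le> k" for i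
      proof -
        have pow: "b ^ i * b ^ (k - i) = b ^ k" "(- 1) ^ i * (- 1) ^ (k - i) = ((- 1) ^ k :: real)"
          using that by (simp_all flip: power_add)
        have "f i * f (k - i) = ((1 / 2 gchoose i) * (1 / 2 gchoose (k - i)) *
            ((- 1) ^ i * (- 1) ^ (k - i))) *\<^sub>R (b ^ i * b ^ (k - i))"
          by (simp add: f_def mult_ac)
        then show ?thesis by (simp only: pow)
      qed
      then have "(\<Sum>i\<le>k. f i * f (k - i))
          = ((\<Sum>i\<le>k. (1 / 2 gchoose i) * (1 / 2 gchoose (k - i))) * (- 1) ^ k) *\<^sub>R b ^ k"
        by (simp add: scaleR_sum_left sum_distrib_right)
      also have "(\<Sum>i\<le>k. (1 / 2 gchoose i) * (1 / 2 gchoose (k - i))) = (of_nat (1 choose k) :: real)"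
        using gbinomial_Vandermonde[of "1 / 2 :: real" "1 / 2" k]
        by (simp add: atLeast0AtMost binomial_gbinomial)
      finally show ?thesis .
    qed
    have "(\<lambda>k. ((of_nat (1 choose k) :: real) * (- 1) ^ k) *\<^sub>R b ^ k) sums (z * z)"
      using Cauchy_product_sums[OF summ summ] by (simp only: conv z_def)
    moreover have "(\<lambda>k. ((of_nat (1 choose k) :: real) * (- 1) ^ k) *\<^sub>R b ^ k) sums
        (\<Sum>k\<in>{0, 1}. ((of_nat (1 choose k) :: real) * (- 1) ^ k) *\<^sub>R b ^ k)"
      by (rule sums_finite) (auto intro!: binomial_eq_0)
    ultimately have "z * z = (\<Sum>k\<in>{0, 1}. ((of_nat (1 choose k) :: real) * (- 1) ^ k) *\<^sub>R b ^ k)"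
      by (rule sums_unique2)
    then show ?thesis by simp
  qed
  ultimately show ?thesis using that by blast
qed

lemma is_state_diff:
  assumes "is_state \<tau>"
  shows "\<tau> (a - b) = \<tau> a - \<tau> b"
proof -
  have "\<tau> ((a - b) + b) = \<tau> (a - b) + \<tau> b" using assms unfolding is_state_def by blast
  then show ?thesis by simp
qed

text \<open>Positivity is tested on a + s1 for scalars s. The value s = 0 makes
  \<open>\<tau> (adj a * a)\<close> real, s = 1 and s = \<open>\<i>\<close> show that
  \<open>\<tau> (adj a)\<close> is the conjugate of \<open>\<tau> a\<close>, and s =
  \<open>- \<tau> a\<close> gives the inequality.\<close>

lemma is_state_Cauchy_Schwarz:
  assumes "is_state \<tau>"
  shows "(cmod (\<tau> a))\<^sup>2 \<le> Re (\<tau> (adj a * a))"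
proof -
  note st = assms[unfolded is_state_def]
  define p q r where "p = \<tau> a" and "q = \<tau> (adj a)" and "r = \<tau> (adj a * a)"
  have pos: "r + s * q + cnj s * p + s * cnj s \<in> \<real>\<^sub>\<ge>\<^sub>0" for s
  proof -
    have one: "x *\<^sub>C 1 * b = x *\<^sub>C b" "b * x *\<^sub>C 1 = x *\<^sub>C b" for x and b :: 'a
      by (simp_all add: scaleC_mult_left scaleC_mult_right)
    have "adj (a + s *\<^sub>C 1) * (a + s *\<^sub>C 1)
        = adj a * a + s *\<^sub>C adj a + (cnj s *\<^sub>C a + (s * cnj s) *\<^sub>C 1)"
      by (simp add: adj_add adj_scaleC distrib_left distrib_right one scaleC_scaleC
          scaleC_add_right mult.commute)
    then have "\<tau> (adj (a + s *\<^sub>C 1) * (a + s *\<^sub>C 1)) = r + s * q + (cnj s * p + s * cnj s)"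
      using st by (simp add: p_def q_def r_def)
    moreover have "\<tau> (adj (a + s *\<^sub>C 1) * (a + s *\<^sub>C 1)) \<in> \<real>\<^sub>\<ge>\<^sub>0" using st by blast
    ultimately show ?thesis by (simp add: add.assoc)
  qed
  have "Im r = 0" using pos[of 0] by (simp add: complex_nonneg_Reals_iff)
  then have "Im p = - Im q" "Re p = Re q"
    using pos[of 1] pos[of \<i>] by (simp_all add: complex_nonneg_Reals_iff)
  then have q: "q = cnj p" by (simp add: complex_eq_iff)
  have "0 \<le> Re (r - p * cnj p)"
    using pos[of "- p"] by (simp add: q complex_nonneg_Reals_iff)
  then show ?thesis
    by (simp add: p_def r_def cmod_power2 flip: power2_eq_square)
qed

text \<open>For \<open>norm b < 1\<close> the element \<open>1 - adj b * b\<close> has a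
  self-adjoint square root, so its state is nonnegative and \<open>\<tau> (adj b * b)\<close> is at
  most 1; Cauchy-Schwarz then bounds \<open>\<tau> b\<close>.\<close>

lemma is_state_le_norm:
  assumes "is_state \<tau>"
  shows "cmod (\<tau> a) \<le> norm a"
proof -
  have le1: "cmod (\<tau> b) \<le> 1" if "norm b < 1" for b
  proof -
    have "norm (adj b * b) < 1"
      using that by (simp add: cstar_identity abs_square_less_1)
    moreover have "adj (adj b * b) = adj b * b" by (simp add: adj_mult adj_adj)
    ultimately obtain z where z: "adj z = z" "z * z = 1 - adj b * b"
      using selfadjoint_sqrt_one_minus by blast
    have "\<tau> (adj z * z) \<in> \<real>\<^sub>\<ge>\<^sub>0" "\<tau> 1 = 1" using assms unfolding is_state_def by blast+
    then have "Re (\<tau> (adj b * b)) \<le> 1"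
      by (simp add: z is_state_diff[OF assms] complex_nonneg_Reals_iff)
    then have "(cmod (\<tau> b))\<^sup>2 \<le> 1\<^sup>2"
      using is_state_Cauchy_Schwarz[OF assms, of b] by simp
    then show ?thesis by (rule power2_le_imp_le) simp
  qed
  show ?thesis
  proof (rule dense_ge)
    \<comment> \<open>Scaling by t strictly above the norm keeps the scaled element in the open unit
      ball, where the square root is available.\<close>
    fix t assume t: "norm a < t"
    then have t0: "0 < t" using norm_ge_zero[of a] by linarith
    let ?b = "complex_of_real (1 / t) *\<^sub>C a"
    have "cmod (\<tau> ?b) \<le> 1"
      by (rule le1) (use t t0 in \<open>simp add: norm_scaleC norm_divide\<close>)
    moreover have "\<tau> ?b = complex_of_real (1 / t) * \<tau> a"
      using assms unfolding is_state_def by blast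
    ultimately have "cmod (complex_of_real (1 / t) * \<tau> a) \<le> 1" by (simp only:)
    then show "cmod (\<tau> a) \<le> t"
      using t0 by (simp add: norm_mult norm_divide field_simps)
  qed
qed


section \<open>The algebra of non-commutative polynomials\<close>

text \<open>Different pairs of words can have the same concatenation; a sum of
  \<open>single\<close>s adds up their coefficients.\<close>

definition ncpoly_mult :: "'v ncpoly \<Rightarrow> 'v ncpoly \<Rightarrow> 'v ncpoly" where
  "ncpoly_mult p q = (\<Sum>w\<in>Poly_Mapping.keys p. \<Sum>w'\<in>Poly_Mapping.keys q.
     Poly_Mapping.single (w @ w') (Poly_Mapping.lookup p w * Poly_Mapping.lookup q w'))"

text \<open>The map \<open>\<sigma>\<close> is meant to send a variable to the one whose value is
  its adjoint. Words are reversed because the involution reverses products.\<close>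

definition ncpoly_adj :: "('v \<Rightarrow> 'v) \<Rightarrow> 'v ncpoly \<Rightarrow> 'v ncpoly" where
  "ncpoly_adj \<sigma> p = (\<Sum>w\<in>Poly_Mapping.keys p.
     Poly_Mapping.single (rev (map \<sigma> w)) (cnj (Poly_Mapping.lookup p w)))"

definition ncpoly_scale :: "complex \<Rightarrow> 'v ncpoly \<Rightarrow> 'v ncpoly" where
  "ncpoly_scale c p =
     (\<Sum>w\<in>Poly_Mapping.keys p. Poly_Mapping.single w (c * Poly_Mapping.lookup p w))"

context complex_unital_algebra
begin

lemma smult_zero_scalar: "b \<in> carrier B \<Longrightarrow> 0 \<odot> b = \<zero>"
  using smult_l_distr[of b 0 0] smult_closed[of b 0]
  by (metis add.r_cancel_one add_0)

lemma smult_zero_elem: "c \<odot> \<zero> = \<zero>"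
  by (metis mult_zero_right smult_smult smult_zero_scalar zero_closed)

lemma smult_finsum:
  assumes "finite I" "f \<in> I \<rightarrow> carrier B"
  shows "c \<odot> (\<Oplus>i\<in>I. f i) = (\<Oplus>i\<in>I. c \<odot> f i)"
  using assms
proof (induction I)
  case (insert i I)
  then have "f \<in> I \<rightarrow> carrier B" "f i \<in> carrier B" by auto
  with insert show ?case
    by (subst (1 2) finsum_insert) (auto simp: smult_r_distr smult_closed Pi_iff)
qed (simp add: smult_zero_elem)

lemma word_eval_append:
  assumes "\<And>l. f l \<in> carrier B"
  shows "word_eval B f (w @ w') = word_eval B f w \<otimes> word_eval B f w'"
  by (induction w) (use assms in \<open>auto simp: word_eval_def m_assoc
      word_eval_closed[unfolded word_eval_def]\<close>)

text \<open>Allows polynomials with different supports, and sums in which terms cancel, to be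
  evaluated over one common index set.\<close>

lemma poly_eval_superset:
  assumes a: "range a \<subseteq> carrier B" and "finite W" "Poly_Mapping.keys p \<subseteq> W"
  shows "poly_eval B a p = (\<Oplus>w\<in>W. Poly_Mapping.lookup p w \<odot> word_eval B a w)"
  unfolding poly_eval_def using assms
  by (intro add.finprod_mono_neutral_cong_left)
    (auto simp: in_keys_iff range_subsetD word_eval_closed smult_zero_scalar intro!: smult_closed)

context
  fixes a :: "'v \<Rightarrow> 'b"
  assumes a: "range a \<subseteq> carrier B"
begin

lemma word_closed: "word_eval B a w \<in> carrier B"
  using a by (intro word_eval_closed) auto

lemma poly_eval_closed: "poly_eval B a p \<in> carrier B"
  unfolding poly_eval_def by (intro finsum_closed) (auto intro: smult_closed word_closed)

lemma poly_eval_add: "poly_eval B a (p + q) = poly_eval B a p \<oplus> poly_eval B a q"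
proof -
  let ?W = "Poly_Mapping.keys p \<union> Poly_Mapping.keys q"
  have "poly_eval B a (p + q)
      = (\<Oplus>w\<in>?W. Poly_Mapping.lookup p w \<odot> word_eval B a w
          \<oplus> Poly_Mapping.lookup q w \<odot> word_eval B a w)"
    using keys_add[of p q]
    by (simp add: poly_eval_superset[OF a, of ?W] lookup_add smult_l_distr word_closed)
  also have "\<dots> = poly_eval B a p \<oplus> poly_eval B a q"
    by (simp add: poly_eval_superset[OF a, of ?W] finsum_addf Pi_def smult_closed word_closed)
  finally show ?thesis .
qed

lemma poly_eval_zero: "poly_eval B a 0 = \<zero>"
  by (simp add: poly_eval_def)

lemma poly_eval_sum:
  "finite I \<Longrightarrow> poly_eval B a (\<Sum>i\<in>I. p i) = (\<Oplus>i\<in>I. poly_eval B a (p i))"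
  by (induction I rule: finite_induct) (auto simp: poly_eval_zero poly_eval_add poly_eval_closed)

lemma poly_eval_single: "poly_eval B a (Poly_Mapping.single w c) = c \<odot> word_eval B a w"
  using poly_eval_superset[OF a, of "{w}" "Poly_Mapping.single w c"]
  by (simp add: finsum_insert[of "{}", simplified] smult_closed word_closed)

lemma poly_eval_scale: "poly_eval B a (ncpoly_scale c p) = c \<odot> poly_eval B a p"
proof -
  have "poly_eval B a (ncpoly_scale c p)
      = (\<Oplus>w\<in>Poly_Mapping.keys p. c \<odot> (Poly_Mapping.lookup p w \<odot> word_eval B a w))"
    by (simp add: ncpoly_scale_def poly_eval_sum poly_eval_single smult_smult word_closed)
  also have "\<dots> = c \<odot> poly_eval B a p"
    unfolding poly_eval_def
    by (rule smult_finsum[symmetric]) (auto intro: smult_closed word_closed)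
  finally show ?thesis .
qed

lemma poly_eval_mult: "poly_eval B a (ncpoly_mult p q) = poly_eval B a p \<otimes> poly_eval B a q"
proof -
  let ?t = "\<lambda>p w. Poly_Mapping.lookup p w \<odot> word_eval B a w"
  have t: "?t p w \<in> carrier B" for p w by (intro smult_closed word_closed)
  have "a l \<in> carrier B" for l using a by auto
  then have "(Poly_Mapping.lookup p w * Poly_Mapping.lookup q w') \<odot> word_eval B a (w @ w')
      = ?t p w \<otimes> ?t q w'" for w w'
    by (simp add: word_eval_append smult_mult_left smult_mult_right[symmetric] smult_smult
        smult_closed word_closed)
  then have "poly_eval B a (ncpoly_mult p q)
      = (\<Oplus>w\<in>Poly_Mapping.keys p. \<Oplus>w'\<in>Poly_Mapping.keys q. ?t p w \<otimes> ?t q w')"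
    by (simp add: ncpoly_mult_def poly_eval_sum poly_eval_single)
  also have "\<dots> = (\<Oplus>w\<in>Poly_Mapping.keys p. ?t p w \<otimes> poly_eval B a q)"
    unfolding poly_eval_def by (intro finsum_cong' finsum_rdistr[symmetric]) (auto simp: t)
  also have "\<dots> = poly_eval B a p \<otimes> poly_eval B a q"
    using poly_eval_closed[of q]
    by (subst (2) poly_eval_def) (intro finsum_ldistr[symmetric], auto simp: t)
  finally show ?thesis .
qed

text \<open>The involution is an abstract \<open>star\<close>, so that one proof covers both the
  adjoint of matrices and that of the algebra.\<close>

lemma poly_eval_adj:
  assumes closed: "\<And>b. b \<in> carrier B \<Longrightarrow> star b \<in> carrier B"
    and add: "\<And>b b'. b \<in> carrier B \<Longrightarrow> b' \<in> carrier B \<Longrightarrow> star (b \<oplus> b') = star b \<oplus> star b'"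
    and scale: "\<And>c b. b \<in> carrier B \<Longrightarrow> star (c \<odot> b) = cnj c \<odot> star b"
    and mult: "\<And>b b'. b \<in> carrier B \<Longrightarrow> b' \<in> carrier B \<Longrightarrow> star (b \<otimes> b') = star b' \<otimes> star b"
    and one: "star \<one> = \<one>"
    and vars: "\<And>l. star (a l) = a (\<sigma> l)"
  shows "poly_eval B a (ncpoly_adj \<sigma> p) = star (poly_eval B a p)"
proof -
  have al: "a l \<in> carrier B" for l using a by auto
  have star_zero: "star \<zero> = \<zero>"
    using scale[of \<zero> 0] by (simp add: smult_zero_scalar closed)
  have word: "star (word_eval B a w) = word_eval B a (rev (map \<sigma> w))" for w
  proof (induction w)
    case (Cons l w)
    have "star (word_eval B a (l # w)) = star (a l \<otimes> word_eval B a w)"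
      by (simp add: word_eval_def)
    also have "\<dots> = word_eval B a (rev (map \<sigma> w)) \<otimes> a (\<sigma> l)"
      by (simp add: mult al word_closed Cons vars)
    also have "\<dots> = word_eval B a (rev (map \<sigma> (l # w)))"
      by (simp add: word_eval_append al) (simp add: word_eval_def al)
    finally show ?case .
  qed (simp add: word_eval_def one)
  have sum: "star (\<Oplus>i\<in>I. f i) = (\<Oplus>i\<in>I. star (f i))"
    if "finite I" "f \<in> I \<rightarrow> carrier B" for I :: "'v list set" and f
    using that
  proof (induction I)
    case (insert i I)
    then have "f \<in> I \<rightarrow> carrier B" "f i \<in> carrier B" by auto
    with insert show ?case
      by (subst (1 2) finsum_insert) (auto simp: add closed Pi_iff)
  qed (simp add: star_zero)
  have "poly_eval B a (ncpoly_adj \<sigma> p)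
      = (\<Oplus>w\<in>Poly_Mapping.keys p. star (Poly_Mapping.lookup p w \<odot> word_eval B a w))"
    by (simp add: ncpoly_adj_def poly_eval_sum poly_eval_single scale word word_closed)
  also have "\<dots> = star (poly_eval B a p)"
    unfolding poly_eval_def by (rule sum[symmetric]) (auto intro: smult_closed word_closed)
  finally show ?thesis .
qed

end

end

lemma mat_alg_simps [simp]:
  "carrier (mat_alg n) = carrier_mat n n" "\<one>\<^bsub>mat_alg n\<^esub> = 1\<^sub>m n" "\<zero>\<^bsub>mat_alg n\<^esub> = 0\<^sub>m n n"
  "A \<otimes>\<^bsub>mat_alg n\<^esub> C = A * C" "A \<oplus>\<^bsub>mat_alg n\<^esub> C = A + C" "c \<odot>\<^bsub>mat_alg n\<^esub> A = c \<cdot>\<^sub>m A"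
  by (simp_all add: mat_alg_def module_mat_def)

lemma cstar_alg_simps [simp]:
  "carrier cstar_alg = UNIV" "\<one>\<^bsub>cstar_alg\<^esub> = 1" "\<zero>\<^bsub>cstar_alg\<^esub> = 0"
  "a \<otimes>\<^bsub>cstar_alg\<^esub> b = a * b" "a \<oplus>\<^bsub>cstar_alg\<^esub> b = a + b" "c \<odot>\<^bsub>cstar_alg\<^esub> a = c *\<^sub>C a"
  by (simp_all add: cstar_alg_def)

interpretation cstar: complex_unital_algebra "cstar_alg :: (complex, 'a::unital_cstar_algebra) module"
  by (rule complex_unital_algebra_cstar_alg)

interpretation mat: complex_unital_algebra "mat_alg n" for n
  by (rule complex_unital_algebra_mat_alg)


section \<open>Approximable sequences of matrices\<close>

text \<open>The deterministic setting for one fixed sample point. Variables and their adjoints form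
  a single family permuted by \<open>\<sigma>\<close>, so polynomials in them are closed under the
  involution. Traces enter only in \<open>approximable_ntr\<close>.\<close>

locale norm_convergent_model =
  fixes Y :: "nat \<Rightarrow> 'v \<Rightarrow> complex mat" and y :: "'v \<Rightarrow> 'a::unital_cstar_algebra"
    and \<sigma> :: "'v \<Rightarrow> 'v"
  assumes Y_closed: "Y n l \<in> carrier_mat n n"
    and Y_adjoint: "mat_adjoint (Y n l) = Y n (\<sigma> l)"
    and y_adj: "adj (y l) = y (\<sigma> l)"
    and norm_limit: "(\<lambda>n. mat_opnorm (poly_eval (mat_alg n) (Y n) p))
      \<longlonglongrightarrow> norm (poly_eval cstar_alg y p)"
begin

abbreviation mpoly :: "'v ncpoly \<Rightarrow> nat \<Rightarrow> complex mat" where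
  "mpoly p n \<equiv> poly_eval (mat_alg n) (Y n) p"

abbreviation cpoly :: "'v ncpoly \<Rightarrow> 'a" where
  "cpoly p \<equiv> poly_eval cstar_alg y p"

definition approximable :: "(nat \<Rightarrow> complex mat) \<Rightarrow> 'a \<Rightarrow> bool" where
  "approximable S a \<longleftrightarrow> (\<forall>n. S n \<in> carrier_mat n n) \<and>
     (\<forall>\<epsilon>>0. \<exists>p. norm (a - cpoly p) < \<epsilon> \<and>
        (\<forall>\<^sub>F n in sequentially. mat_opnorm (S n - mpoly p n) < \<epsilon>))"

lemma range_Y: "range (Y n) \<subseteq> carrier (mat_alg n)"
  using Y_closed by auto

lemma range_y: "range y \<subseteq> carrier cstar_alg"
  by simp

lemma mpoly_carrier [simp]: "mpoly p n \<in> carrier_mat n n"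
  using mat.poly_eval_closed[OF range_Y, of n p] by simp

lemmas mpoly_eval = mat.poly_eval_add[OF range_Y] mat.poly_eval_scale[OF range_Y]
  mat.poly_eval_mult[OF range_Y] mat.poly_eval_zero[OF range_Y] mat.poly_eval_single[OF range_Y]

lemmas cpoly_eval = cstar.poly_eval_add[OF range_y] cstar.poly_eval_scale[OF range_y]
  cstar.poly_eval_mult[OF range_y] cstar.poly_eval_zero[OF range_y] cstar.poly_eval_single[OF range_y]

lemma mpoly_adj: "mpoly (ncpoly_adj \<sigma> p) n = mat_adjoint (mpoly p n)"
  by (rule mat.poly_eval_adj[OF range_Y])
    (auto simp: mat_adjoint_add mat_adjoint_mult mat_adjoint_smult Y_adjoint)

lemma cpoly_adj: "cpoly (ncpoly_adj \<sigma> p) = adj (cpoly p)"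
  by (rule cstar.poly_eval_adj[OF range_y]) (auto simp: adj_add adj_mult adj_scaleC y_adj)

lemma approximable_carrier: "approximable S a \<Longrightarrow> S n \<in> carrier_mat n n"
  by (simp add: approximable_def)

lemma approximableE:
  assumes "approximable S a" "0 < \<epsilon>"
  obtains p where "norm (a - cpoly p) < \<epsilon>"
    and "\<forall>\<^sub>F n in sequentially. mat_opnorm (S n - mpoly p n) < \<epsilon>"
  using assms unfolding approximable_def by blast

lemma approximable_poly: "approximable (mpoly p) (cpoly p)"
proof -
  have "mat_opnorm (0\<^sub>m n n) \<le> 0" for n
  proof (rule mat_opnorm_leI[of _ n n])
    show "vec_l2norm (0\<^sub>m n n *\<^sub>v v) \<le> 0 * vec_l2norm v" if "v \<in> carrier_vec n" for v
    proof -
      have "0\<^sub>m n n *\<^sub>v v = 0\<^sub>v n" using that by (intro eq_vecI) auto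
      then show ?thesis by simp
    qed
  qed auto
  then have "mat_opnorm (0\<^sub>m n n) < \<epsilon>" if "0 < \<epsilon>" for n \<epsilon> using that by (meson le_less_trans)
  moreover have "mpoly p n - mpoly p n = 0\<^sub>m n n" for n
    using mpoly_carrier by (rule minus_r_inv_mat)
  ultimately have "mat_opnorm (mpoly p n - mpoly p n) < \<epsilon>" if "0 < \<epsilon>" for n \<epsilon>
    using that by (simp only:)
  then show ?thesis
    unfolding approximable_def
    by (intro conjI allI impI exI[of _ p] always_eventually) simp_all
qed

text \<open>Half of the error goes to the approximable pair and half to its polynomial. This lets
  the inverse be approximated by truncated Neumann series instead of directly by
  polynomials.\<close>

lemma approximable_limit:
  assumes "\<And>n. S n \<in> carrier_mat n n"
    and "\<And>\<epsilon>. 0 < \<epsilon> \<Longrightarrow> \<exists>T t. approximable T t \<and> norm (a - t) < \<epsilon> \<and>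
      (\<forall>\<^sub>F n in sequentially. mat_opnorm (S n - T n) < \<epsilon>)"
  shows "approximable S a"
  unfolding approximable_def
proof (intro conjI allI impI)
  fix \<epsilon> :: real assume \<epsilon>: "0 < \<epsilon>"
  obtain T t where T: "approximable T t" "norm (a - t) < \<epsilon> / 2"
      "\<forall>\<^sub>F n in sequentially. mat_opnorm (S n - T n) < \<epsilon> / 2"
    using assms(2)[of "\<epsilon> / 2"] \<epsilon> by auto
  obtain p where p: "norm (t - cpoly p) < \<epsilon> / 2"
      "\<forall>\<^sub>F n in sequentially. mat_opnorm (T n - mpoly p n) < \<epsilon> / 2"
    using approximableE[OF T(1), of "\<epsilon> / 2"] \<epsilon> by auto
  have "norm (a - cpoly p) < \<epsilon>"
    using T(2) p(1) norm_diff_triangle_less by fastforce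
  moreover have "\<forall>\<^sub>F n in sequentially. mat_opnorm (S n - mpoly p n) < \<epsilon>"
    using T(3) p(2)
  proof eventually_elim
    case (elim n)
    then show ?case
      using mat_opnorm_minus_triangle[OF assms(1) approximable_carrier[OF T(1)] mpoly_carrier[of n p]]
      by (smt (verit) field_sum_of_halves)
  qed
  ultimately show "\<exists>p. norm (a - cpoly p) < \<epsilon> \<and>
      (\<forall>\<^sub>F n in sequentially. mat_opnorm (S n - mpoly p n) < \<epsilon>)" by blast
qed (fact assms(1))

lemma approximable_norm:
  assumes S: "approximable S a"
  shows "(\<lambda>n. mat_opnorm (S n)) \<longlonglongrightarrow> norm a"
proof (rule tendstoI)
  fix \<epsilon> :: real assume \<epsilon>: "0 < \<epsilon>"
  obtain p where p: "norm (a - cpoly p) < \<epsilon> / 3"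
      "\<forall>\<^sub>F n in sequentially. mat_opnorm (S n - mpoly p n) < \<epsilon> / 3"
    using approximableE[OF S, of "\<epsilon> / 3"] \<epsilon> by auto
  have "\<forall>\<^sub>F n in sequentially. dist (mat_opnorm (mpoly p n)) (norm (cpoly p)) < \<epsilon> / 3"
    using norm_limit \<epsilon> by (intro tendstoD) auto
  then show "\<forall>\<^sub>F n in sequentially. dist (mat_opnorm (S n)) (norm a) < \<epsilon>"
    using p(2)
  proof eventually_elim
    case (elim n)
    note C = approximable_carrier[OF S, of n] mpoly_carrier[of n p]
    have "\<bar>mat_opnorm (S n) - mat_opnorm (mpoly p n)\<bar> \<le> mat_opnorm (S n - mpoly p n)"
      using mat_opnorm_triangle[OF C] mat_opnorm_triangle[OF C(2,1)] mat_opnorm_minus_commute[OF C]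
      by linarith
    moreover have "\<bar>norm a - norm (cpoly p)\<bar> \<le> norm (a - cpoly p)"
      by (rule norm_triangle_ineq3)
    ultimately show ?case
      using elim p(1) unfolding dist_real_def by linarith
  qed
qed

lemma approximable_eventually_le:
  assumes "approximable S a" "norm a < K"
  shows "\<forall>\<^sub>F n in sequentially. mat_opnorm (S n) < K"
  using order_tendstoD(2)[OF approximable_norm] assms by blast

lemma approximable_ntr:
  assumes S: "approximable S a" and st: "is_state \<tau>"
    and trace_limit: "\<And>p. (\<lambda>n. ntr (mpoly p n)) \<longlonglongrightarrow> \<tau> (cpoly p)"
  shows "(\<lambda>n. ntr (S n)) \<longlonglongrightarrow> \<tau> a"
proof (rule tendstoI)
  fix \<epsilon> :: real assume \<epsilon>: "0 < \<epsilon>"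
  obtain p where p: "norm (a - cpoly p) < \<epsilon> / 3"
      "\<forall>\<^sub>F n in sequentially. mat_opnorm (S n - mpoly p n) < \<epsilon> / 3"
    using approximableE[OF S, of "\<epsilon> / 3"] \<epsilon> by auto
  have "\<forall>\<^sub>F n in sequentially. dist (ntr (mpoly p n)) (\<tau> (cpoly p)) < \<epsilon> / 3"
    using trace_limit \<epsilon> by (intro tendstoD) auto
  then show "\<forall>\<^sub>F n in sequentially. dist (ntr (S n)) (\<tau> a) < \<epsilon>"
    using p(2)
  proof eventually_elim
    case (elim n)
    note C = approximable_carrier[OF S, of n] mpoly_carrier[of n p]
    have "dist (ntr (S n)) (ntr (mpoly p n)) \<le> mat_opnorm (S n - mpoly p n)"
      using ntr_le_mat_opnorm[OF minus_carrier_mat[OF C(2)], of "S n"]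
      by (simp add: dist_norm ntr_diff[OF C])
    moreover have "dist (\<tau> a) (\<tau> (cpoly p)) \<le> norm (a - cpoly p)"
      using is_state_le_norm[OF st, of "a - cpoly p"] by (simp add: dist_norm is_state_diff[OF st])
    ultimately show ?case
      using elim p(1) dist_triangle[of "ntr (S n)" "\<tau> a" "ntr (mpoly p n)"]
        dist_triangle[of "ntr (mpoly p n)" "\<tau> a" "\<tau> (cpoly p)"]
        dist_commute[of "\<tau> a" "\<tau> (cpoly p)"] by linarith
  qed
qed

section \<open>Closure under the algebra operations and the involution\<close>

lemma approximable_add:
  assumes S: "approximable S a" and T: "approximable T b"
  shows "approximable (\<lambda>n. S n + T n) (a + b)"
  unfolding approximable_def
proof (intro conjI allI impI)
  show "S n + T n \<in> carrier_mat n n" for n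
    using S T by (simp add: approximable_carrier)
  fix \<epsilon> :: real assume \<epsilon>: "0 < \<epsilon>"
  obtain p where p: "norm (a - cpoly p) < \<epsilon> / 2"
      "\<forall>\<^sub>F n in sequentially. mat_opnorm (S n - mpoly p n) < \<epsilon> / 2"
    using approximableE[OF S, of "\<epsilon> / 2"] \<epsilon> by auto
  obtain q where q: "norm (b - cpoly q) < \<epsilon> / 2"
      "\<forall>\<^sub>F n in sequentially. mat_opnorm (T n - mpoly q n) < \<epsilon> / 2"
    using approximableE[OF T, of "\<epsilon> / 2"] \<epsilon> by auto
  have "norm ((a + b) - cpoly (p + q)) < \<epsilon>"
    using p(1) q(1) norm_triangle_ineq[of "a - cpoly p" "b - cpoly q"]
    by (simp add: cpoly_eval algebra_simps)
  moreover have "\<forall>\<^sub>F n in sequentially. mat_opnorm ((S n + T n) - mpoly (p + q) n) < \<epsilon>"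
    using p(2) q(2)
  proof eventually_elim
    case (elim n)
    note C = approximable_carrier[OF S, of n] approximable_carrier[OF T, of n]
      mpoly_carrier[of n p] mpoly_carrier[of n q]
    have "(S n + T n) - mpoly (p + q) n = (S n - mpoly p n) + (T n - mpoly q n)"
      using C[THEN carrier_matD(1)] C[THEN carrier_matD(2)]
      by (intro eq_matI) (auto simp: mpoly_eval)
    then show ?case
      using elim C mat_opnorm_add_le[of "S n - mpoly p n" n n "T n - mpoly q n"]
      by (simp add: minus_carrier_mat)
  qed
  ultimately show "\<exists>p. norm ((a + b) - cpoly p) < \<epsilon> \<and>
      (\<forall>\<^sub>F n in sequentially. mat_opnorm ((S n + T n) - mpoly p n) < \<epsilon>)" by blast
qed

lemma approximable_mult:
  assumes S: "approximable S a" and T: "approximable T b"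
  shows "approximable (\<lambda>n. S n * T n) (a * b)"
  unfolding approximable_def
proof (intro conjI allI impI)
  show "S n * T n \<in> carrier_mat n n" for n
    using S T by (intro mult_carrier_mat[of _ n n] approximable_carrier)
  fix \<epsilon> :: real assume \<epsilon>: "0 < \<epsilon>"
  \<comment> \<open>The error of a product splits as (a - p)b + p(b - q). On both sides the factor b
    is bounded by \<open>norm b + 1\<close> and the factor p by \<open>norm a + 2\<close>: the
    matrices \<open>S n\<close> eventually have norm below \<open>norm a + 1\<close>, and p adds at
    most \<open>\<delta> \<le> 1\<close>. The two bounds sum to K.\<close>
  define K where "K = norm a + norm b + 3"
  define \<delta> where "\<delta> = min 1 (\<epsilon> / K)"
  have K: "K > 0" unfolding K_def by (intro add_nonneg_pos add_nonneg_nonneg) auto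
  then have \<delta>: "0 < \<delta>" "\<delta> \<le> 1" "\<delta> * K \<le> \<epsilon>" using \<epsilon> by (auto simp: \<delta>_def min_def field_simps)
  have bound: "d * t + s * d' < \<epsilon>"
    if "d < \<delta>" "d' < \<delta>" "0 \<le> d" "0 \<le> t" "t \<le> norm b + 1" "s \<le> norm a + 2" "0 \<le> d'" for d d' s t
  proof -
    have "d * t \<le> \<delta> * (norm b + 1)"
      using that by (intro mult_mono) auto
    moreover have "s * d' \<le> (norm a + 2) * d'" using that by (intro mult_right_mono) auto
    moreover have "(norm a + 2) * d' < (norm a + 2) * \<delta>"
      using that by (intro mult_strict_left_mono) (auto intro: add_nonneg_pos)
    ultimately have "d * t + s * d' < \<delta> * K"
      by (simp add: K_def algebra_simps)
    then show ?thesis using \<delta>(3) by simp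
  qed
  obtain p where p: "norm (a - cpoly p) < \<delta>"
      "\<forall>\<^sub>F n in sequentially. mat_opnorm (S n - mpoly p n) < \<delta>"
    using approximableE[OF S \<delta>(1)] by auto
  obtain q where q: "norm (b - cpoly q) < \<delta>"
      "\<forall>\<^sub>F n in sequentially. mat_opnorm (T n - mpoly q n) < \<delta>"
    using approximableE[OF T \<delta>(1)] by auto
  have "norm (a * b - cpoly (ncpoly_mult p q)) < \<epsilon>"
  proof -
    have "norm (cpoly p) \<le> norm a + 2"
      using norm_triangle_ineq2[of "cpoly p" a] p(1) \<delta>(2) norm_minus_commute[of a "cpoly p"] by linarith
    then have lt: "norm (a - cpoly p) * norm b + norm (cpoly p) * norm (b - cpoly q) < \<epsilon>"
      using p(1) q(1) by (intro bound) auto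
    have eq: "a * b - cpoly (ncpoly_mult p q) = (a - cpoly p) * b + cpoly p * (b - cpoly q)"
      by (simp add: cpoly_eval algebra_simps)
    show ?thesis
      unfolding eq using lt norm_triangle_ineq[of "(a - cpoly p) * b" "cpoly p * (b - cpoly q)"]
        norm_mult_ineq[of "a - cpoly p" b] norm_mult_ineq[of "cpoly p" "b - cpoly q"] by linarith
  qed
  moreover have "\<forall>\<^sub>F n in sequentially. mat_opnorm (S n * T n - mpoly (ncpoly_mult p q) n) < \<epsilon>"
    using p(2) q(2) approximable_eventually_le[OF S less_add_one] approximable_eventually_le[OF T less_add_one]
  proof eventually_elim
    case (elim n)
    let ?P = "mpoly p n" and ?Q = "mpoly q n"
    note C = approximable_carrier[OF S, of n] approximable_carrier[OF T, of n]
      mpoly_carrier[of n p] mpoly_carrier[of n q]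
    note D = minus_carrier_mat[OF C(3), of "S n"] minus_carrier_mat[OF C(4), of "T n"]
    have "mat_opnorm ?P \<le> norm a + 2"
      using mat_opnorm_triangle[OF C(3,1)] elim \<delta>(2) mat_opnorm_minus_commute[OF C(1,3)] by linarith
    then have "mat_opnorm (S n - ?P) * mat_opnorm (T n) + mat_opnorm ?P * mat_opnorm (T n - ?Q) < \<epsilon>"
      using elim by (intro bound) auto
    moreover have "S n * T n - mpoly (ncpoly_mult p q) n = (S n - ?P) * T n + ?P * (T n - ?Q)"
    proof -
      have "(S n - ?P) * T n = S n * T n - ?P * T n" "?P * (T n - ?Q) = ?P * T n - ?P * ?Q"
        by (rule minus_mult_distrib_mat[OF C(1,3,2)], rule mult_minus_distrib_mat[OF C(3,2,4)])
      then show ?thesis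
        using C[THEN carrier_matD(1)] C[THEN carrier_matD(2)]
        by (simp add: mpoly_eval) (intro eq_matI, auto)
    qed
    ultimately show ?case
      using mat_opnorm_add_le[OF mult_carrier_mat[OF D(1) C(2)] mult_carrier_mat[OF C(3) D(2)]]
        mat_opnorm_mult_le[OF D(1) C(2)] mat_opnorm_mult_le[OF C(3) D(2)] by simp
  qed
  ultimately show "\<exists>p. norm (a * b - cpoly p) < \<epsilon> \<and>
      (\<forall>\<^sub>F n in sequentially. mat_opnorm (S n * T n - mpoly p n) < \<epsilon>)" by blast
qed

lemma approximable_one: "approximable (\<lambda>n. 1\<^sub>m n) 1"
proof -
  have "mpoly (Poly_Mapping.single [] 1) = (\<lambda>n. 1\<^sub>m n)"
    by (rule ext, simp add: mpoly_eval word_eval_def) (intro eq_matI, auto)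
  moreover have "cpoly (Poly_Mapping.single [] 1) = 1"
    using scaleC_scaleR[of 1 "1 :: 'a"] by (simp add: cpoly_eval word_eval_def)
  ultimately show ?thesis using approximable_poly[of "Poly_Mapping.single [] 1"] by simp
qed

lemma approximable_zero: "approximable (\<lambda>n. 0\<^sub>m n n) 0"
  using approximable_poly[of 0] by (simp add: cpoly_eval mpoly_eval)

lemma approximable_smult:
  assumes S: "approximable S a"
  shows "approximable (\<lambda>n. c \<cdot>\<^sub>m S n) (c *\<^sub>C a)"
proof -
  let ?p = "Poly_Mapping.single [] c"
  have "mpoly ?p n = c \<cdot>\<^sub>m 1\<^sub>m n" "cpoly ?p = c *\<^sub>C 1" for n
    by (auto simp: mpoly_eval cpoly_eval word_eval_def)
  then have "approximable (\<lambda>n. c \<cdot>\<^sub>m 1\<^sub>m n * S n) (c *\<^sub>C 1 * a)"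
    using approximable_mult[OF approximable_poly[of ?p] S] by (simp only:)
  moreover have "c \<cdot>\<^sub>m 1\<^sub>m n * S n = c \<cdot>\<^sub>m S n" for n
    using approximable_carrier[OF S, of n]
    by (simp add: mult_smult_assoc_mat[of _ n n _ n] left_mult_one_mat[of _ n n])
  ultimately show ?thesis by (simp add: scaleC_mult_left)
qed

lemma approximable_diff:
  assumes S: "approximable S a" and T: "approximable T b"
  shows "approximable (\<lambda>n. S n - T n) (a - b)"
proof -
  have "S n + (- 1) \<cdot>\<^sub>m T n = S n - T n" for n
    using approximable_carrier[OF S, of n] approximable_carrier[OF T, of n]
    by (intro eq_matI) auto
  moreover have "a + (- 1) *\<^sub>C b = a - b"
    using scaleC_scaleR[of "- 1" b] by simp
  ultimately show ?thesis
    using approximable_add[OF S approximable_smult[OF T, of "- 1"]] by simp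
qed

lemma approximable_adj:
  assumes S: "approximable S a"
  shows "approximable (\<lambda>n. mat_adjoint (S n)) (adj a)"
  unfolding approximable_def
proof (intro conjI allI impI)
  show "mat_adjoint (S n) \<in> carrier_mat n n" for n
    using S by (simp add: approximable_carrier)
  fix \<epsilon> :: real assume \<epsilon>: "0 < \<epsilon>"
  obtain p where p: "norm (a - cpoly p) < \<epsilon>"
      "\<forall>\<^sub>F n in sequentially. mat_opnorm (S n - mpoly p n) < \<epsilon>"
    using approximableE[OF S \<epsilon>] by auto
  have "norm (adj a - cpoly (ncpoly_adj \<sigma> p)) < \<epsilon>"
    using p(1) by (simp add: cpoly_adj flip: adj_diff)
  moreover have "\<forall>\<^sub>F n in sequentially. mat_opnorm (mat_adjoint (S n) - mpoly (ncpoly_adj \<sigma> p) n) < \<epsilon>"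
    using p(2)
  proof eventually_elim
    case (elim n)
    note C = approximable_carrier[OF S, of n] mpoly_carrier[of n p]
    show ?case
      using elim mat_opnorm_adjoint_le[OF minus_carrier_mat[OF C(2)], of "S n"]
      by (simp add: mpoly_adj mat_adjoint_minus[OF C])
  qed
  ultimately show "\<exists>p. norm (adj a - cpoly p) < \<epsilon> \<and>
      (\<forall>\<^sub>F n in sequentially. mat_opnorm (mat_adjoint (S n) - mpoly p n) < \<epsilon>)" by blast
qed

section \<open>Geometric sums and inverses\<close>

lemma approximable_geometric:
  assumes U: "approximable U u"
  shows "approximable (\<lambda>n. geometric_mat n (U n) k) (\<Sum>i<k. u ^ i)"
proof (induction k)
  case 0
  show ?case using approximable_zero by simp
next
  case (Suc k)
  have "(\<Sum>i<Suc k. u ^ i) = 1 + u * (\<Sum>i<k. u ^ i)"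
    by (simp add: sum.lessThan_Suc_shift sum_distrib_left del: sum.lessThan_Suc)
  then show ?case
    using approximable_add[OF approximable_one approximable_mult[OF U Suc]] by simp
qed

lemma geometric_sum_one_minus:
  fixes u :: 'a
  shows "(1 - u) * (\<Sum>i<k. u ^ i) = 1 - u ^ k" and "(\<Sum>i<k. u ^ i) * (1 - u) = 1 - u ^ k"
proof -
  show "(1 - u) * (\<Sum>i<k. u ^ i) = 1 - u ^ k"
    by (induction k) (simp_all add: distrib_left, simp add: left_diff_distrib)
  show "(\<Sum>i<k. u ^ i) * (1 - u) = 1 - u ^ k"
    by (induction k) (simp_all add: distrib_right, simp add: right_diff_distrib power_commutes)
qed

text \<open>The invertibility of \<open>a\<close> in the algebra says nothing about the matrices beforehand. If \<open>u\<close> had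
  norm one, then its geometric sums would have norm about \<open>k\<close>, since this is so for the matrices
  \<open>1 - A\<^sup>*A/c\<close>; but these sums are bounded because \<open>1 - u\<close> is invertible.\<close>

lemma norm_one_minus_less_one:
  assumes A: "approximable A a" and inv: "a * g = 1" "g * a = 1"
    and c: "0 < c" "\<forall>\<^sub>F n in sequentially. (mat_opnorm (A n))\<^sup>2 \<le> c"
    and U: "approximable (\<lambda>n. 1\<^sub>m n - complex_of_real (1 / c) \<cdot>\<^sub>m (mat_adjoint (A n) * A n)) u"
      "1 - u = (1 / c) *\<^sub>R (adj a * a)"
  shows "norm u < 1"
proof (rule ccontr)
  let ?U = "\<lambda>n. 1\<^sub>m n - complex_of_real (1 / c) \<cdot>\<^sub>m (mat_adjoint (A n) * A n)"
  assume "\<not> norm u < 1"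
  moreover have "norm u \<le> 1"
  proof (rule tendsto_upperbound[OF approximable_norm[OF U(1)]])
    show "\<forall>\<^sub>F n in sequentially. mat_opnorm (?U n) \<le> 1"
      using c(2) by eventually_elim
        (rule mat_opnorm_one_minus_le[OF approximable_carrier[OF A] c(1)])
  qed simp
  ultimately have u: "norm u = 1" by simp
  have lower: "real k - 1 \<le> norm (\<Sum>i<k. u ^ i)" for k
  proof -
    \<comment> \<open>The matrix bound tends to k as s tends to 1, so some s < 1 keeps it above k -
      1. Strictness of s < 1 = \<open>norm u\<close> is what makes the norms of the matrices
      eventually exceed s.\<close>
    have "((\<lambda>s. real k * s - (real k)\<^sup>2 * sqrt (1 - s\<^sup>2))
        \<longlongrightarrow> real k * 1 - (real k)\<^sup>2 * sqrt (1 - 1\<^sup>2)) (at_left 1)"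
      by (intro tendsto_intros)
    then have "\<forall>\<^sub>F s in at_left 1. real k - 1 < real k * s - (real k)\<^sup>2 * sqrt (1 - s\<^sup>2)"
      by (rule order_tendstoD) simp
    moreover have "\<forall>\<^sub>F s in at_left 1. s \<in> {0<..<1::real}"
      by (rule eventually_at_left_real) simp
    ultimately have "\<forall>\<^sub>F s in at_left (1::real).
        real k - 1 < real k * s - (real k)\<^sup>2 * sqrt (1 - s\<^sup>2) \<and> s \<in> {0<..<1}"
      by (rule eventually_conj)
    then obtain s where s: "real k - 1 < real k * s - (real k)\<^sup>2 * sqrt (1 - s\<^sup>2)" "0 < s" "s < 1"
      using eventually_happens'[OF trivial_limit_at_left_real] by fastforce
    have "\<forall>\<^sub>F n in sequentially. s < mat_opnorm (?U n)"
      using s(3) u by (intro order_tendstoD(1)[OF approximable_norm[OF U(1)]]) simp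
    then have "\<forall>\<^sub>F n in sequentially. real k - 1 \<le> mat_opnorm (geometric_mat n (?U n) k)"
      using c(2)
    proof eventually_elim
      case (elim n)
      then show ?case
        using geometric_mat_opnorm_ge[OF approximable_carrier[OF A] c(1) elim(2) refl _ elim(1), of k] s
        by linarith
    qed
    then show ?thesis
      by (rule tendsto_lowerbound[OF approximable_norm[OF approximable_geometric[OF U(1)]]]) simp
  qed
  \<comment> \<open>A left inverse of \<open>adj a * a\<close>, so c times h is a left inverse of 1
    - u. Applied to (1 - u)t = 1 - u^k it isolates the geometric sum t and bounds it independently
    of k.\<close>
  define h where "h = g * adj g"
  have "h * (adj a * a) = g * adj (a * g) * a"
    by (simp add: h_def adj_mult mult.assoc)
  then have h: "h * (adj a * a) = 1" by (simp add: inv)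
  have upper: "norm (\<Sum>i<k. u ^ i) \<le> c * norm h * 2" for k
  proof -
    let ?t = "\<Sum>i<k. u ^ i"
    have "c *\<^sub>R (h * (1 - u ^ k)) = c *\<^sub>R (h * ((1 - u) * ?t))"
      by (simp add: geometric_sum_one_minus)
    also have "\<dots> = (h * (adj a * a)) * ?t"
      using c(1) by (simp add: U(2) mult.assoc)
    finally have "?t = c *\<^sub>R (h * (1 - u ^ k))" by (simp add: h)
    then have "norm ?t \<le> c * (norm h * norm (1 - u ^ k))"
      using norm_mult_ineq[of h "1 - u ^ k"] c(1) by (simp add: mult_left_mono)
    also have "norm (1 - u ^ k) \<le> 2"
      using norm_triangle_ineq4[of 1 "u ^ k"] norm_power_ineq[of u k] u by simp
    finally show ?thesis using c(1) by (simp add: mult_left_mono mult.assoc)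
  qed
  obtain k where "c * norm h * 2 + 1 < real k" using reals_Archimedean2 by blast
  then show False using lower[of k] upper[of k] by linarith
qed

lemma approximable_inverse:
  assumes A: "approximable A a" and inv: "a * g = 1" "g * a = 1"
  obtains S where "approximable S g"
    and "\<forall>\<^sub>F n in sequentially. A n * S n = 1\<^sub>m n \<and> S n * A n = 1\<^sub>m n"
proof -
  \<comment> \<open>K lies strictly above the limit of the norms of \<open>A n\<close>, so c = K^2
    eventually dominates their squares, as the contraction estimate requires.\<close>
  define K where "K = norm a + 1"
  define c where "c = K\<^sup>2"
  define C where "C = complex_of_real (1 / c)"
  have K: "0 < K" unfolding K_def by (rule add_nonneg_pos) auto
  then have c: "0 < c" by (simp add: c_def)
  have AK: "\<forall>\<^sub>F n in sequentially. mat_opnorm (A n) < K"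
    unfolding K_def by (rule approximable_eventually_le[OF A less_add_one])
  then have Ac: "\<forall>\<^sub>F n in sequentially. (mat_opnorm (A n))\<^sup>2 \<le> c"
    by eventually_elim (auto simp: c_def intro: power_mono)
  define U where "U n = 1\<^sub>m n - C \<cdot>\<^sub>m (mat_adjoint (A n) * A n)" for n
  define u where "u = 1 - C *\<^sub>C (adj a * a)"
  have U: "approximable U u"
    unfolding U_def u_def
    by (intro approximable_diff approximable_one approximable_smult approximable_mult
        approximable_adj A)
  have u: "1 - u = (1 / c) *\<^sub>R (adj a * a)"
    by (simp add: u_def C_def scaleC_scaleR del: of_real_divide)
  have "norm u < 1"
    by (rule norm_one_minus_less_one[OF A inv c Ac U[unfolded U_def C_def] u])
  then obtain \<rho> where \<rho>: "norm u < \<rho>" "\<rho> < 1" using dense by blast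
  then have \<rho>0: "0 \<le> \<rho>" using norm_ge_zero[of u] by linarith
  have U\<rho>: "\<forall>\<^sub>F n in sequentially. mat_opnorm (U n) < \<rho>"
    by (rule approximable_eventually_le[OF U \<rho>(1)])
  define P where "P n B \<longleftrightarrow> B \<in> carrier_mat n n \<and> A n * B = 1\<^sub>m n \<and> B * A n = 1\<^sub>m n" for n B
  \<comment> \<open>The zero matrix is a default for those n at which \<open>A n\<close> is not
    invertible: approximability demands the right size for every n but closeness only
    eventually.\<close>
  define S where "S n = (if \<exists>B. P n B then SOME B. P n B else 0\<^sub>m n n)" for n
  have PS: "P n (S n)" if "P n B" for n B
    using that unfolding S_def by (auto intro: someI)
  have S_carrier: "S n \<in> carrier_mat n n" for n
    using PS[of n] by (cases "\<exists>B. P n B") (auto simp: P_def S_def)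
  have evP: "\<forall>\<^sub>F n in sequentially. P n (S n)"
    using U\<rho>
  proof eventually_elim
    case (elim n)
    then have "mat_opnorm (1\<^sub>m n - C \<cdot>\<^sub>m (mat_adjoint (A n) * A n)) < 1"
      using \<rho>(2) by (simp add: U_def)
    from mat_inverse_if_contraction[OF approximable_carrier[OF A] this] show ?case
      using PS unfolding P_def by metis
  qed
  \<comment> \<open>The first summand bounds the norms of the inverses \<open>S n\<close> for large
    n and the second bounds g, so one k serves both sides; the 1 makes M positive.\<close>
  define M where "M = cmod C * K / (1 - \<rho>) + norm g + 1"
  have M1: "0 \<le> cmod C * K / (1 - \<rho>)" using K \<rho>(2) by simp
  then have M: "0 < M" unfolding M_def by (intro add_nonneg_pos add_nonneg_nonneg) auto
  have "approximable S g"
  proof (rule approximable_limit[OF S_carrier])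
    fix \<epsilon> :: real assume "0 < \<epsilon>"
    then obtain k where "\<rho> ^ k < \<epsilon> / M"
      using real_arch_pow_inv[OF _ \<rho>(2), of "\<epsilon> / M"] M by auto
    then have k: "\<rho> ^ k * M < \<epsilon>" using M by (simp add: field_simps)
    let ?T = "\<lambda>n. geometric_mat n (U n) k * (C \<cdot>\<^sub>m mat_adjoint (A n))"
    let ?t = "(\<Sum>i<k. u ^ i) * C *\<^sub>C adj a"
    have "approximable ?T ?t"
      by (intro approximable_mult approximable_geometric approximable_smult approximable_adj A U)
    moreover have "norm (g - ?t) < \<epsilon>"
    proof -
      \<comment> \<open>Evaluated in two ways: the telescoping sum gives (1 - u^k)g, while 1 - u =
        \<open>adj a * a\<close> over c together with ag = 1 gives the truncated series. Hence the
        error is exactly u^k g.\<close>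
      have "(\<Sum>i<k. u ^ i) * (1 - u) * g = (1 / c) *\<^sub>R ((\<Sum>i<k. u ^ i) * adj a * (a * g))"
        by (simp add: u mult.assoc)
      also have "\<dots> = ?t"
        by (simp add: inv C_def scaleC_scaleR del: of_real_divide)
      finally have "g - ?t = u ^ k * g"
        by (simp add: geometric_sum_one_minus left_diff_distrib) (metis diff_diff_eq2 add_diff_cancel_left')
      then have "norm (g - ?t) \<le> norm (u ^ k) * norm g" by (simp add: norm_mult_ineq)
      also have "\<dots> \<le> \<rho> ^ k * M"
      proof (rule mult_mono)
        show "norm (u ^ k) \<le> \<rho> ^ k"
          using norm_power_ineq[of u k] power_mono[of "norm u" \<rho> k] \<rho>(1) by simp
        show "norm g \<le> M" using M1 by (simp add: M_def)
      qed (use \<rho>0 in auto)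
      finally show ?thesis using k by simp
    qed
    moreover have "\<forall>\<^sub>F n in sequentially. mat_opnorm (S n - ?T n) < \<epsilon>"
      using evP U\<rho> AK
    proof eventually_elim
      case (elim n)
      have B: "S n \<in> carrier_mat n n" "A n * S n = 1\<^sub>m n" using elim(1) by (auto simp: P_def)
      note AS = approximable_carrier[OF A, of n] B
      have "mat_opnorm (S n) \<le> cmod C * mat_opnorm (A n) / (1 - \<rho>)"
        using mat_inverse_opnorm_le[OF AS _ \<rho>(2)] elim(2) by (simp add: U_def)
      also have "\<dots> \<le> cmod C * K / (1 - \<rho>)"
        using elim(3) \<rho>(2) by (intro divide_right_mono mult_left_mono) auto
      also have "\<dots> \<le> M" by (simp add: M_def)
      finally have "\<rho> ^ k * mat_opnorm (S n) \<le> \<rho> ^ k * M"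
        using \<rho>0 by (intro mult_left_mono) auto
      moreover have "mat_opnorm (S n - ?T n) \<le> \<rho> ^ k * mat_opnorm (S n)"
        using mat_inverse_Neumann[OF AS U_def] elim(2) by simp
      ultimately show ?case using k by linarith
    qed
    ultimately show "\<exists>T t. approximable T t \<and> norm (g - t) < \<epsilon> \<and>
        (\<forall>\<^sub>F n in sequentially. mat_opnorm (S n - T n) < \<epsilon>)" by blast
  qed
  moreover have "\<forall>\<^sub>F n in sequentially. A n * S n = 1\<^sub>m n \<and> S n * A n = 1\<^sub>m n"
    using evP by eventually_elim (simp add: P_def)
  ultimately show ?thesis using that by blast
qed

section \<open>Evaluation of rational expressions\<close>

lemma approximable_word_eval:
  assumes "\<And>l. l \<in> set w \<Longrightarrow> approximable (F l) (f l)"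
  shows "approximable (\<lambda>n. word_eval (mat_alg n) (\<lambda>l. F l n) w) (word_eval cstar_alg f w)"
  using assms by (induction w) (simp_all add: word_eval_def approximable_one approximable_mult)

lemma approximable_finsum:
  assumes "finite I" "\<And>i. i \<in> I \<Longrightarrow> approximable (F i) (f i)"
  shows "approximable (\<lambda>n. \<Oplus>\<^bsub>mat_alg n\<^esub> i\<in>I. F i n) (\<Oplus>\<^bsub>cstar_alg\<^esub> i\<in>I. f i)"
  using assms
proof (induction I)
  case empty
  then show ?case using approximable_zero by simp
next
  case (insert i I)
  have "(\<Oplus>\<^bsub>mat_alg n\<^esub> j\<in>insert i I. F j n) = F i n + (\<Oplus>\<^bsub>mat_alg n\<^esub> j\<in>I. F j n)" for n
    using insert by (subst mat.finsum_insert) (auto simp: Pi_iff intro: approximable_carrier)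
  moreover have "(\<Oplus>\<^bsub>cstar_alg\<^esub> j\<in>insert i I. f j) = f i + (\<Oplus>\<^bsub>cstar_alg\<^esub> j\<in>I. f j)"
    using insert by (subst cstar.finsum_insert) auto
  ultimately show ?case
    using insert by (simp add: approximable_add)
qed

text \<open>Each letter is evaluable only from some n on. An expression contains finitely many
  letters, so these thresholds have a common bound, and no uniformity over all expressions is
  required.\<close>

lemma approximable_rat_expr:
  assumes "evaluates_to cstar_alg y r b"
  shows "\<exists>S. approximable S b \<and>
    (\<forall>\<^sub>F n in sequentially. evaluates_to (mat_alg n) (Y n) r (S n))"
  using assms
proof induction
  case (Poly p)
  show ?case
    by (intro exI[of _ "mpoly p"] conjI approximable_poly always_eventually allI evaluates_to.Poly)
next
  case (Comb S v)
  define L where "L = (\<Union>wc\<in>fset S. set (fst wc))"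
  have L: "\<exists>w c. (w, c) \<in> fset S \<and> l \<in> set w" if "l \<in> L" for l
    using that by (auto simp: L_def)
  have "\<exists>T. Plain q \<in> L \<or> Inverse q \<in> L \<longrightarrow> approximable T (v q) \<and>
      (\<forall>\<^sub>F n in sequentially. evaluates_to (mat_alg n) (Y n) q (T n))" for q
    using Comb.IH(1)[of _ _ q] Comb.IH(2)[of _ _ q] L[of "Plain q"] L[of "Inverse q"] by blast
  then obtain V where V: "\<And>q. Plain q \<in> L \<or> Inverse q \<in> L \<Longrightarrow> approximable (V q) (v q) \<and>
      (\<forall>\<^sub>F n in sequentially. evaluates_to (mat_alg n) (Y n) q (V q n))"
    by metis
  have "\<forall>q. \<exists>T. Inverse q \<in> L \<longrightarrow> approximable T (inv\<^bsub>cstar_alg\<^esub> (v q)) \<and>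
      (\<forall>\<^sub>F n in sequentially. V q n * T n = 1\<^sub>m n \<and> T n * V q n = 1\<^sub>m n)"
  proof
    fix q
    show "\<exists>T. Inverse q \<in> L \<longrightarrow> approximable T (inv\<^bsub>cstar_alg\<^esub> (v q)) \<and>
      (\<forall>\<^sub>F n in sequentially. V q n * T n = 1\<^sub>m n \<and> T n * V q n = 1\<^sub>m n)"
    proof (cases "Inverse q \<in> L")
      case True
      then have "v q \<in> Units cstar_alg" using Comb.IH(2)[of _ _ q] L[of "Inverse q"] by blast
      then have "v q * inv\<^bsub>cstar_alg\<^esub> (v q) = 1" "inv\<^bsub>cstar_alg\<^esub> (v q) * v q = 1"
        by (rule cstar.Units_r_inv[unfolded cstar_alg_simps],
            rule cstar.Units_l_inv[unfolded cstar_alg_simps])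
      moreover have "approximable (V q) (v q)" using V True by blast
      ultimately obtain T where "approximable T (inv\<^bsub>cstar_alg\<^esub> (v q))"
          "\<forall>\<^sub>F n in sequentially. V q n * T n = 1\<^sub>m n \<and> T n * V q n = 1\<^sub>m n"
        using approximable_inverse by blast
      then show ?thesis by blast
    qed simp
  qed
  from choice[OF this] obtain G where G: "\<And>q. Inverse q \<in> L \<Longrightarrow>
      approximable (G q) (inv\<^bsub>cstar_alg\<^esub> (v q)) \<and>
      (\<forall>\<^sub>F n in sequentially. V q n * G q n = 1\<^sub>m n \<and> G q n * V q n = 1\<^sub>m n)"
    by blast
  \<comment> \<open>Inverse letters use the sequences from \<open>approximable_inverse\<close>,
    which have the right size for every n, whereas the ring inverse of \<open>V q n\<close> is
    meaningful only once that matrix is a unit. From then on both agree.\<close>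
  define F where "F = case_letter V G"
  have F: "approximable (F l) (letter_eval cstar_alg v l)" if "l \<in> L" for l
    using that V G by (cases l) (auto simp: F_def)
  define R where "R n = (\<Oplus>\<^bsub>mat_alg n\<^esub> wc\<in>fset S.
      snd wc \<odot>\<^bsub>mat_alg n\<^esub> word_eval (mat_alg n) (\<lambda>l. F l n) (fst wc))" for n
  have "approximable R (\<Oplus>\<^bsub>cstar_alg\<^esub> wc \<in> fset S.
      snd wc \<odot>\<^bsub>cstar_alg\<^esub> word_eval cstar_alg (letter_eval cstar_alg v) (fst wc))"
    unfolding R_def mat_alg_simps cstar_alg_simps
  proof (intro approximable_finsum approximable_smult approximable_word_eval F)
    show "l \<in> L" if "wc \<in> fset S" "l \<in> set (fst wc)" for wc l
      using that unfolding L_def by blast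
  qed simp
  moreover have "\<forall>\<^sub>F n in sequentially. evaluates_to (mat_alg n) (Y n) (Comb S) (R n)"
  proof -
    have "\<forall>\<^sub>F n in sequentially. (\<forall>q. l = Plain q \<longrightarrow> evaluates_to (mat_alg n) (Y n) q (V q n)) \<and>
        (\<forall>q. l = Inverse q \<longrightarrow> evaluates_to (mat_alg n) (Y n) q (V q n) \<and>
          V q n * G q n = 1\<^sub>m n \<and> G q n * V q n = 1\<^sub>m n)" if "l \<in> L" for l
    proof (cases l)
      case (Plain q)
      with V[of q] that show ?thesis by simp
    next
      case (Inverse q)
      with V[of q] G[of q] that show ?thesis by (simp add: eventually_conj_iff)
    qed
    then have "\<forall>\<^sub>F n in sequentially. \<forall>l\<in>L. (\<forall>q. l = Plain q \<longrightarrow> evaluates_to (mat_alg n) (Y n) q (V q n)) \<and>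
        (\<forall>q. l = Inverse q \<longrightarrow> evaluates_to (mat_alg n) (Y n) q (V q n) \<and>
          V q n * G q n = 1\<^sub>m n \<and> G q n * V q n = 1\<^sub>m n)"
      by (intro eventually_ball_finite) (auto simp: L_def)
    then show ?thesis
    proof eventually_elim
      case (elim n)
      have carr: "V q n \<in> carrier (mat_alg n)" "G q n \<in> carrier (mat_alg n)" if "Inverse q \<in> L" for q
        using V[of q] G[of q] that approximable_carrier by auto
      have unit: "V q n \<in> Units (mat_alg n)" if "Inverse q \<in> L" for q
        using carr[OF that] elim that unfolding Units_def by fastforce
      have letter: "letter_eval (mat_alg n) (\<lambda>q. V q n) l = F l n" if l: "l \<in> L" for l
      proof (cases l)
        case (Inverse q)
        then have "inv\<^bsub>mat_alg n\<^esub> (V q n) = G q n"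
          using elim l carr[of q] by (intro mat.inv_unique'[symmetric]) auto
        then show ?thesis by (simp add: Inverse F_def)
      qed (simp add: F_def)
      have word: "word_eval (mat_alg n) (letter_eval (mat_alg n) (\<lambda>q. V q n)) (fst wc)
          = word_eval (mat_alg n) (\<lambda>l. F l n) (fst wc)" if "wc \<in> fset S" for wc
        using that by (intro mat.word_eval_cong letter) (auto simp: L_def)
      have closed: "word_eval (mat_alg n) (\<lambda>l. F l n) (fst wc) \<in> carrier (mat_alg n)"
        if "wc \<in> fset S" for wc
        using that F approximable_carrier
        by (intro mat.word_eval_closed) (fastforce simp: L_def)
      have "R n = (\<Oplus>\<^bsub>mat_alg n\<^esub> wc\<in>fset S. snd wc \<odot>\<^bsub>mat_alg n\<^esub>
          word_eval (mat_alg n) (letter_eval (mat_alg n) (\<lambda>q. V q n)) (fst wc))"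
        unfolding R_def using closed by (intro mat.finsum_cong') (auto simp: word)
      moreover have "evaluates_to (mat_alg n) (Y n) (Comb S)
          (\<Oplus>\<^bsub>mat_alg n\<^esub> wc\<in>fset S. snd wc \<odot>\<^bsub>mat_alg n\<^esub>
            word_eval (mat_alg n) (letter_eval (mat_alg n) (\<lambda>q. V q n)) (fst wc))"
      proof (rule evaluates_to.Comb)
        fix w c q assume "(w, c) \<in> fset S"
        then have w: "set w \<subseteq> L" by (force simp: L_def)
        show "evaluates_to (mat_alg n) (Y n) q (V q n)" if "Plain q \<in> set w"
          using elim w that by blast
        show "evaluates_to (mat_alg n) (Y n) q (V q n) \<and> V q n \<in> Units (mat_alg n)"
          if "Inverse q \<in> set w"
          using elim w that unit by blast
      qed
      ultimately show ?case by simp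
    qed
  qed
  ultimately show ?case by blast
qed

end


section \<open>Strong convergence of rational expressions\<close>

theorem corollary1:
  fixes M :: "'w measure"
    and X :: "nat \<Rightarrow> 'm::finite \<Rightarrow> 'w \<Rightarrow> complex mat"
    and \<tau> :: "'a::unital_cstar_algebra \<Rightarrow> complex"
    and x :: "'m \<Rightarrow> 'a"
    and r :: "('m + 'm) rat_expr"
  assumes "prob_space M"
    and "\<And>n. prob_space.indep_vars M (\<lambda>_. mat_borel n) (X n) UNIV"
    and "is_state \<tau>" and "is_faithful \<tau>" and "is_tracial \<tau>"
    and "freely_independent \<tau> x"
    and "AE \<omega> in M. strongly_converges (\<lambda>n i. X n i \<omega>) \<tau> x"
    and "r \<in> rational_expressions"
    and "with_adj adj x \<in> rat_domain cstar_alg r"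
  shows "AE \<omega> in M.
    (\<forall>\<^sub>F n in sequentially.
       with_adj mat_adjoint (\<lambda>i. X n i \<omega>) \<in> rat_domain (mat_alg n) r) \<and>
    ((\<lambda>n. ntr (rat_eval (mat_alg n) (with_adj mat_adjoint (\<lambda>i. X n i \<omega>)) r))
       \<longlonglongrightarrow> \<tau> (rat_eval cstar_alg (with_adj adj x) r)) \<and>
    ((\<lambda>n. mat_opnorm (rat_eval (mat_alg n) (with_adj mat_adjoint (\<lambda>i. X n i \<omega>)) r))
       \<longlonglongrightarrow> norm (rat_eval cstar_alg (with_adj adj x) r))"
  \<comment> \<open>Convergence of all polynomials holds off one null set, so the rest is
    deterministic at a fixed sample point; membership in the space is what measurability needs
    below.\<close>
  using assms(7) AE_space
proof eventually_elim
  case (elim \<omega>)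
  define Y where "Y n = with_adj mat_adjoint (\<lambda>i. X n i \<omega>)" for n
  define y where "y = with_adj adj x"
  have X: "X n i \<omega> \<in> carrier_mat n n" for n i
  proof -
    \<comment> \<open>Independence includes measurability into \<open>mat_borel n\<close>, whose
      space consists of the n by n matrices; this fixes the size of the samples.\<close>
    have "X n i \<in> measurable M (mat_borel n)"
      using assms(2)[of n] unfolding prob_space.indep_vars_def2[OF assms(1)] by auto
    then have "X n i \<omega> \<in> space (mat_borel n)" using elim(2) by (rule measurable_space)
    then show ?thesis by (simp add: mat_borel_def)
  qed
  have Yn: "Y n l \<in> carrier_mat n n" for n l
    using X by (cases l) (simp_all add: Y_def with_adj_def)
  \<comment> \<open>Taking adjoints exchanges the two copies of the index type in the doubled
    tuple.\<close>
  interpret norm_convergent_model Y y "case_sum Inr Inl"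
  proof
    show "mat_adjoint (Y n l) = Y n (case_sum Inr Inl l)" for n l
      by (cases l) (simp_all add: Y_def with_adj_def)
    show "adj (y l) = y (case_sum Inr Inl l)" for l
      by (cases l) (simp_all add: y_def with_adj_def adj_adj)
    show "(\<lambda>n. mat_opnorm (poly_eval (mat_alg n) (Y n) p)) \<longlonglongrightarrow> norm (poly_eval cstar_alg y p)" for p
      using elim(1) unfolding strongly_converges_def Y_def y_def by blast
  qed (rule Yn)
  obtain b where b: "evaluates_to cstar_alg y r b"
    using assms(9) by (auto simp: rat_domain_def y_def)
  obtain S where S: "approximable S b"
      "\<forall>\<^sub>F n in sequentially. evaluates_to (mat_alg n) (Y n) r (S n)"
    using approximable_rat_expr[OF b] by blast
  have "\<forall>\<^sub>F n in sequentially. Y n \<in> rat_domain (mat_alg n) r"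
    using S(2) by eventually_elim (use range_Y in \<open>auto simp: rat_domain_def\<close>)
  moreover have ev: "\<forall>\<^sub>F n in sequentially. rat_eval (mat_alg n) (Y n) r = S n"
    using S(2) by eventually_elim (rule mat.rat_eval_eqI[OF range_Y])
  moreover have rb: "rat_eval cstar_alg y r = b"
    by (rule cstar.rat_eval_eqI[OF range_y b])
  moreover have "(\<lambda>n. ntr (poly_eval (mat_alg n) (Y n) p)) \<longlonglongrightarrow> \<tau> (poly_eval cstar_alg y p)" for p
    using elim(1) unfolding strongly_converges_def Y_def y_def by blast
  then have "(\<lambda>n. ntr (S n)) \<longlonglongrightarrow> \<tau> b"
    by (rule approximable_ntr[OF S(1) assms(3)])
  \<comment> \<open>For small n the expression may have no value and \<open>rat_eval\<close> is then
    unspecified, so the limits are transferred along eventual equality with S.\<close>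
  moreover have "(\<lambda>n. ntr (rat_eval (mat_alg n) (Y n) r)) \<longlonglongrightarrow> \<tau> b \<longleftrightarrow> (\<lambda>n. ntr (S n)) \<longlonglongrightarrow> \<tau> b"
    by (rule tendsto_cong) (use ev in eventually_elim, simp)
  moreover have "(\<lambda>n. mat_opnorm (rat_eval (mat_alg n) (Y n) r)) \<longlonglongrightarrow> norm b
      \<longleftrightarrow> (\<lambda>n. mat_opnorm (S n)) \<longlonglongrightarrow> norm b"
    by (rule tendsto_cong) (use ev in eventually_elim, simp)
  ultimately show ?case
    using approximable_norm[OF S(1)] by (simp add: Y_def[symmetric] y_def[symmetric])
qed

end
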